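(* Let $A\subset\mathbb{D}$ be a Lie subalgebra. There exists a smooth germ $X\subset(\mathbb{C}^n,0)$ with $X\neq\emptyset$ and $X\neq(\mathbb{C}^n,0)$ such that $A=\mathbb{D}_X$ if and only if $A$ is a maximal visible subalgebra of $\mathbb{D}$, i.e. a maximal balanced subalgebra of $\mathbb{D}$.
   Context: $\mathcal{O}_n$ denotes the algebra of germs of holomorphic functions $(\mathbb{C}^n,0)\to\mathbb{C}$, and $\mathbb{D}=\operatorname{Der}\mathcal{O}_n$ the Lie algebra of germs of analytic vector fields on $(\mathbb{C}^n,0)$. A "germ of analytic variety" means a reduced (possibly reducible) complex space germ $X\subset(\mathbb{C}^n,0)$; $I_X\subset\mathcal{O}_n$ is the ideal of function germs vanishing on $X$. The tangent algebra of $X$ is $\mathbb{D}_X=\{D\in\mathbb{D}: D(I_X)\subset I_X\}$. For a Lie algebra $B$, a subalgebra $A\subset B$ is called balanced in $B$ if $A$ contains no nonzero ideal of $B$, but $A$ contains an element $a\neq0$ with $[a,B]\subset A$ and $[[a,B],B]\subset A$. A subalgebra is maximal visible in $B$ if it is a maximal element (for inclusion) among balanced subalgebras of $B$. *)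

theory Defs
  imports "HOL-Analysis.Analysis"
begin

text \<open>Points of (C^n,0) are vectors of type complex^'n (n = CARD('n)).
  Germs are represented by representatives; germ equality is agreement on a
  neighbourhood of 0 (eventually in nhds 0).\<close>

definition holo_on :: "(complex^'n \<Rightarrow> complex) \<Rightarrow> (complex^'n) set \<Rightarrow> bool" where
  "holo_on f S \<longleftrightarrow> open S \<and> (\<forall>x\<in>S. \<exists>f'. (f has_derivative f') (at x) \<and>
       (\<forall>c v. f' (c *s v) = c * f' v))"

definition holo_vec_on :: "(complex^'n \<Rightarrow> complex^'m) \<Rightarrow> (complex^'n) set \<Rightarrow> bool" where
  "holo_vec_on F S \<longleftrightarrow> (\<forall>i. holo_on (\<lambda>x. F x $ i) S)"

definition hol_germ :: "(complex^'n \<Rightarrow> complex) \<Rightarrow> bool" where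
  "hol_germ f \<longleftrightarrow> (\<exists>S. 0 \<in> S \<and> holo_on f S)"

definition hol_vf :: "(complex^'n \<Rightarrow> complex^'n) \<Rightarrow> bool" where
  "hol_vf V \<longleftrightarrow> (\<exists>S. 0 \<in> S \<and> holo_vec_on V S)"

definition vf_apply :: "(complex^'n \<Rightarrow> complex^'n) \<Rightarrow> (complex^'n \<Rightarrow> complex) \<Rightarrow> complex^'n \<Rightarrow> complex" where
  "vf_apply V f = (\<lambda>x. frechet_derivative f (at x) (V x))"

definition vf_bracket :: "(complex^'n \<Rightarrow> complex^'n) \<Rightarrow> (complex^'n \<Rightarrow> complex^'n) \<Rightarrow> complex^'n \<Rightarrow> complex^'n" where
  "vf_bracket V W = (\<lambda>x. \<chi> i. vf_apply V (\<lambda>y. W y $ i) x - vf_apply W (\<lambda>y. V y $ i) x)"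

definition vf_germ :: "(complex^'n \<Rightarrow> complex^'n) \<Rightarrow> (complex^'n \<Rightarrow> complex^'n) set" where
  "vf_germ V = {W. hol_vf W \<and> (\<forall>\<^sub>F x in nhds 0. W x = V x)}"

text \<open>The Lie algebra D = Der O_n, as the set of germs of analytic vector fields.\<close>
definition Der :: "(complex^'n \<Rightarrow> complex^'n) set set" where
  "Der = {vf_germ V | V. hol_vf V}"

definition rep :: "(complex^'n \<Rightarrow> complex^'n) set \<Rightarrow> (complex^'n \<Rightarrow> complex^'n)" where
  "rep G = (SOME V. V \<in> G)"

definition gzero :: "(complex^'n \<Rightarrow> complex^'n) set" where
  "gzero = vf_germ (\<lambda>x. 0)"

definition gadd where
  "gadd G H = vf_germ (\<lambda>x. rep G x + rep H x)"

definition gscale :: "complex \<Rightarrow> (complex^'n \<Rightarrow> complex^'n) set \<Rightarrow> (complex^'n \<Rightarrow> complex^'n) set" where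
  "gscale c G = vf_germ (\<lambda>x. c *s rep G x)"

definition gbr where
  "gbr G H = vf_germ (vf_bracket (rep G) (rep H))"

definition lie_subalg :: "(complex^'n \<Rightarrow> complex^'n) set set \<Rightarrow> bool" where
  "lie_subalg A \<longleftrightarrow> A \<subseteq> Der \<and> gzero \<in> A \<and>
     (\<forall>a\<in>A. \<forall>b\<in>A. gadd a b \<in> A) \<and> (\<forall>c. \<forall>a\<in>A. gscale c a \<in> A) \<and>
     (\<forall>a\<in>A. \<forall>b\<in>A. gbr a b \<in> A)"

definition lie_ideal_in :: "(complex^'n \<Rightarrow> complex^'n) set set \<Rightarrow> (complex^'n \<Rightarrow> complex^'n) set set \<Rightarrow> bool" where
  "lie_ideal_in I B \<longleftrightarrow> lie_subalg I \<and> I \<subseteq> B \<and> (\<forall>i\<in>I. \<forall>b\<in>B. gbr i b \<in> I)"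

definition balanced_in :: "(complex^'n \<Rightarrow> complex^'n) set set \<Rightarrow> (complex^'n \<Rightarrow> complex^'n) set set \<Rightarrow> bool" where
  "balanced_in A B \<longleftrightarrow> lie_subalg A \<and> A \<subseteq> B \<and>
     \<not> (\<exists>I. lie_ideal_in I B \<and> I \<subseteq> A \<and> I \<noteq> {gzero}) \<and>
     (\<exists>a\<in>A. a \<noteq> gzero \<and> (\<forall>b\<in>B. gbr a b \<in> A) \<and> (\<forall>b\<in>B. \<forall>c\<in>B. gbr (gbr a b) c \<in> A))"

definition maximal_visible_in :: "(complex^'n \<Rightarrow> complex^'n) set set \<Rightarrow> (complex^'n \<Rightarrow> complex^'n) set set \<Rightarrow> bool" where
  "maximal_visible_in A B \<longleftrightarrow> balanced_in A B \<and> (\<forall>A'. balanced_in A' B \<and> A \<subseteq> A' \<longrightarrow> A' = A)"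

definition vanishing_ideal :: "(complex^'n) set \<Rightarrow> (complex^'n \<Rightarrow> complex) set" where
  "vanishing_ideal X = {f. hol_germ f \<and> (\<forall>\<^sub>F x in nhds 0. x \<in> X \<longrightarrow> f x = 0)}"

definition tangent_alg :: "(complex^'n) set \<Rightarrow> (complex^'n \<Rightarrow> complex^'n) set set" where
  "tangent_alg X = {G \<in> Der. \<forall>f \<in> vanishing_ideal X. vf_apply (rep G) f \<in> vanishing_ideal X}"

definition empty_germ :: "(complex^'n) set \<Rightarrow> bool" where
  "empty_germ X \<longleftrightarrow> (\<forall>\<^sub>F x in nhds 0. x \<notin> X)"

definition full_germ :: "(complex^'n) set \<Rightarrow> bool" where
  "full_germ X \<longleftrightarrow> (\<forall>\<^sub>F x in nhds 0. x \<in> X)"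

definition smooth_germ :: "(complex^'n) set \<Rightarrow> bool" where
  "smooth_germ X \<longleftrightarrow> empty_germ X \<or>
     (\<exists>U (\<phi>::complex^'n \<Rightarrow> complex^'n) L. open U \<and> 0 \<in> U \<and> holo_vec_on \<phi> U \<and> inj_on \<phi> U \<and>
        open (\<phi> ` U) \<and> holo_vec_on (inv_into U \<phi>) (\<phi> ` U) \<and> \<phi> 0 = 0 \<and>
        subspace L \<and> (\<forall>c. \<forall>v\<in>L. c *s v \<in> L) \<and>
        \<phi> ` (X \<inter> U) = L \<inter> \<phi> ` U)"

end

theory Submission
  imports Defs "HOL-Complex_Analysis.Cauchy_Integral_Formula"
begin

text \<open>If \<open>A\<close> is balanced, an identity between double brackets shows that \<open>f Der \<subseteq> A\<close> for some nonzero germ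
  \<open>f\<close>. Let \<open>P\<close> be the largest ideal of germs vanishing at \<open>0\<close> that is stable under \<open>A\<close>. It
  contains \<open>f\<close>, because a unit \<open>g\<close> with \<open>g Der \<subseteq> A\<close> would make \<open>A\<close> contain the ideal \<open>Der\<close>.
  Take as many \<open>g\<^sub>i\<close> from \<open>P\<close> as possible such that, completed by further germs, some Jacobian determinant
  is not in \<open>P\<close>. By maximality of \<open>P\<close> the determinant may be taken nonzero at \<open>0\<close>, so the germs are
  coordinates, and by maximality of the choice \<open>P\<close> is stable under the remaining coordinate fields.
  Taylor expansion along lines then shows that \<open>P\<close> vanishes on the submanifold \<open>X\<close> where the chosen
  \<open>g\<^sub>i\<close> vanish; hence \<open>A \<subseteq> D\<^sub>X\<close>, and \<open>X\<close> is proper as \<open>P \<noteq> 0\<close>. This avoids integrating vector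
  fields and the singular locus.

  Conversely, \<open>D\<^sub>X\<close> is balanced for smooth proper \<open>X\<close>: a nonzero ideal of \<open>Der\<close> contains
  fields with every value at \<open>0\<close>, and \<open>f\<^sup>3 e\<close> with \<open>f\<close> in the ideal of \<open>X\<close> and \<open>e\<close> constant
  is an element as required. Finally \<open>D\<^sub>X \<subseteq> D\<^sub>Y\<close> forces equality, so the \<open>D\<^sub>X\<close> are exactly the maximal
  balanced subalgebras.\<close>

subsection \<open>Holomorphic functions of several variables\<close>


abbreviation dd :: "(complex^'n \<Rightarrow> complex) \<Rightarrow> complex^'n \<Rightarrow> complex^'n \<Rightarrow> complex" where
  "dd f x \<equiv> frechet_derivative f (at x)"

text \<open>The condition of \<open>holo_on\<close> at a single point. Holomorphy near
  \<open>x\<close> becomes \<open>eventually (cdiff f) (nhds x)\<close>, a form in which domains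
  need not be tracked.\<close>

definition cdiff :: "(complex^'n \<Rightarrow> complex) \<Rightarrow> complex^'n \<Rightarrow> bool" where
  "cdiff f x \<longleftrightarrow> (\<exists>f'. (f has_derivative f') (at x) \<and> (\<forall>c v. f' (c *s v) = c * f' v))"

lemma holo_on_iff: "holo_on f S \<longleftrightarrow> open S \<and> (\<forall>x\<in>S. cdiff f x)"
  by (simp add: holo_on_def cdiff_def)

lemma dd_eq: "(f has_derivative f') (at x) \<Longrightarrow> dd f x = f'"
  by (metis frechet_derivative_at)

lemma cdiff_has_derivative: "cdiff f x \<Longrightarrow> (f has_derivative dd f x) (at x)"
  by (auto simp: cdiff_def dest: dd_eq)

lemma cdiff_dd_scale: "cdiff f x \<Longrightarrow> dd f x (c *s v) = c * dd f x v"
  by (auto simp: cdiff_def dest: dd_eq)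

lemma cdiffI: "(f has_derivative f') (at x) \<Longrightarrow> (\<And>c v. f' (c *s v) = c * f' v) \<Longrightarrow> cdiff f x"
  by (auto simp: cdiff_def)

lemma cdiff_isCont: "cdiff f x \<Longrightarrow> isCont f x"
  using cdiff_has_derivative has_derivative_continuous by blast

lemma cdiff_bounded_linear: "cdiff f x \<Longrightarrow> bounded_linear (dd f x)"
  using cdiff_has_derivative has_derivative_bounded_linear by blast

lemma scaleR_complex: "r *\<^sub>R (z::complex) = of_real r * z"
  by (simp add: scaleR_conv_of_real)

lemma norm_smult: "norm (c *s (v::complex^'n)) = cmod c * norm v"
  by (simp add: norm_vec_def L2_set_def norm_mult power_mult_distrib real_sqrt_mult
      flip: sum_distrib_left)

lemma bounded_linear_smult_left: "bounded_linear (\<lambda>z. z *s (v::complex^'n))"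
  by (rule bounded_linear_intro[where K="norm v"])
     (simp_all add: norm_smult vec_eq_iff distrib_right scaleR_complex)

lemmas has_derivative_smult_left [derivative_intros] =
  bounded_linear.has_derivative[OF bounded_linear_smult_left]

lemmas continuous_on_smult_left [continuous_intros] =
  bounded_linear.continuous_on[OF bounded_linear_smult_left]

lemma cdiff_line:
  assumes "cdiff f (x + z *s v)"
  shows "((\<lambda>z. f (x + z *s v)) has_field_derivative dd f (x + z *s v) v) (at z)"
proof -
  have 1: "((\<lambda>z. x + z *s v) has_derivative (\<lambda>z. z *s v)) (at z)"
    by (auto intro!: derivative_eq_intros)
  have "((\<lambda>z. f (x + z *s v)) has_derivative (\<lambda>h. dd f (x + z *s v) (h *s v))) (at z)"
    using has_derivative_compose[OF 1 cdiff_has_derivative[OF assms]] .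
  then show ?thesis
    by (simp add: has_field_derivative_def cdiff_dd_scale[OF assms] mult.commute[of _ "dd _ _ _"] cong: )
qed

section \<open>Cauchy's formula for directional derivatives and its consequences\<close>

definition circ :: "real \<Rightarrow> real \<Rightarrow> complex" where
  "circ r t = of_real r * exp (2 * of_real pi * \<i> * of_real t)"

text \<open>With \<open>z = circ r t\<close> one has \<open>dz = 2 * pi * \<i> * z dt\<close>, so
  the Cauchy kernel \<open>dz / (2 * pi * \<i> * z^2)\<close> of the first derivative becomes
  \<open>dt / z\<close>, and \<open>cker r t\<close> is \<open>1 / z\<close>.\<close>

definition cker :: "real \<Rightarrow> real \<Rightarrow> complex" where
  "cker r t = exp (- (2 * of_real pi * \<i> * of_real t)) / of_real r"

lemma norm_circ [simp]: "r > 0 \<Longrightarrow> cmod (circ r t) = r"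
  by (simp add: circ_def norm_mult)

lemma continuous_on_circ [continuous_intros]:
  "continuous_on S g \<Longrightarrow> continuous_on S (\<lambda>x. circ r (g x))"
  unfolding circ_def by (intro continuous_intros)

lemma continuous_on_cker [continuous_intros]:
  "r > 0 \<Longrightarrow> continuous_on S g \<Longrightarrow> continuous_on S (\<lambda>x. cker r (g x))"
  unfolding cker_def by (intro continuous_intros) auto

text \<open>Cauchy's formula for the first derivative at 0 of the one-variable function
  \<open>z \<mapsto> f (x + z *s v)\<close>. It expresses \<open>dd f x v\<close> by values of
  \<open>f\<close> through an integral over a fixed interval, so regularity in \<open>x\<close>
  passes from \<open>f\<close> to its derivative.\<close>

lemma dd_cauchy:
  assumes S: "open S" "\<And>y. y \<in> S \<Longrightarrow> cdiff f y"
    and r: "r > 0" "\<And>z. cmod z \<le> r \<Longrightarrow> x + z *s v \<in> S"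
  shows "((\<lambda>t. f (x + circ r t *s v)
            * cker r t) has_integral dd f x v) {0..1}"
proof -
  let ?g = "\<lambda>z. f (x + z *s v)"
  have fd: "(?g has_field_derivative dd f (x + z *s v) v) (at z)" if "cmod z \<le> r" for z
    using cdiff_line S(2) r(2) that by blast
  have hol: "?g holomorphic_on ball 0 r"
    unfolding holomorphic_on_def field_differentiable_def
    using fd has_field_derivative_at_within by (metis less_imp_le mem_ball_0)
  have cont: "continuous_on (cball 0 r) ?g"
    using fd DERIV_isCont by (metis continuous_at_imp_continuous_on mem_cball_0)
  have "((\<lambda>u. ?g u / (u-0) ^ (Suc 1)) has_contour_integral ((2 * pi * \<i>) / (fact 1) * (deriv ^^ 1) ?g 0)) (circlepath 0 r)"
    using cont hol by (rule Cauchy_has_contour_integral_higher_derivative_circlepath) (use r in auto)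
  moreover have "deriv ?g 0 = dd f x v"
    using fd[of 0] r by (auto dest: DERIV_imp_deriv)
  ultimately have "((\<lambda>u. ?g u / u ^ 2) has_contour_integral ((2 * pi * \<i>) * dd f x v)) (circlepath 0 r)"
    by (simp add: power2_eq_square)
  then have "((\<lambda>t. ?g (circlepath 0 r t) / (circlepath 0 r t)^2 *
       vector_derivative (circlepath 0 r) (at t within {0..1})) has_integral (2 * pi * \<i>) * dd f x v) {0..1}"
    by (simp add: has_contour_integral_def)
  then have "((\<lambda>t. (1/(2*pi*\<i>)) * (?g (circlepath 0 r t) / (circlepath 0 r t)^2 *
       vector_derivative (circlepath 0 r) (at t within {0..1}))) has_integral (1/(2*pi*\<i>)) * ((2 * pi * \<i>) * dd f x v)) {0..1}"
    by (rule has_integral_mult_right)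
  moreover have "(1/(2*pi*\<i>)) * (?g (circlepath 0 r t) / (circlepath 0 r t)^2 *
       vector_derivative (circlepath 0 r) (at t within {0..1})) =
       f (x + circ r t *s v)
            * cker r t" if "t \<in> {0..1}" for t
    using that r
    by (subst vector_derivative_circlepath01)
       (auto simp: circ_def cker_def circlepath power2_eq_square exp_minus field_simps)
  ultimately show ?thesis
    by (subst (asm) has_integral_cong) auto
qed

text \<open>One radius has to serve all base points near \<open>x0\<close>, so that the Cauchy
  integral has the same path and kernel for all of them.\<close>

lemma cdiff_ball_radius:
  assumes "open S" "(x0::complex^'n) \<in> S"
  obtains d r where "d > 0" "r > 0" "\<And>x z. x \<in> ball x0 d \<Longrightarrow> cmod z \<le> r \<Longrightarrow> x + z *s v \<in> S"
proof -
  obtain e where e: "e > 0" "ball x0 e \<subseteq> S" using assms open_contains_ball by blast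
  \<comment> \<open>The \<open>+ 1\<close> keeps \<open>r\<close> positive also for
    \<open>v = 0\<close>.\<close>
  define r where "r = e / (2 * (norm v + 1))"
  have r: "r > 0" "r * norm v < e/2"
    using e by (auto simp: r_def divide_simps add_nonneg_pos algebra_simps)
      (smt (verit, best) mult_nonneg_nonneg norm_ge_zero)+
  show ?thesis
  proof (rule that[of "e/2" r])
    fix x z assume x: "x \<in> ball x0 (e/2)" and z: "cmod z \<le> r"
    have "norm (z *s v) \<le> r * norm v" using z by (simp add: norm_smult mult_right_mono)
    then have "dist x0 (x + z *s v) < e"
      using x r dist_triangle[of x0 "x + z *s v" x] by (simp add: dist_norm)
    then show "x + z *s v \<in> S" using e by auto
  qed (use e r in auto)
qed

lemma dd_cauchy_ball:
  assumes "open S" "\<And>y. y \<in> S \<Longrightarrow> cdiff f y"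
    and "r > 0" "\<And>x z. x \<in> B \<Longrightarrow> cmod z \<le> r \<Longrightarrow> x + z *s v \<in> S" "x \<in> B"
  shows "(\<lambda>t. f (x + circ r t *s v) * cker r t) integrable_on cbox 0 1"
    and "integral (cbox 0 1) (\<lambda>t. f (x + circ r t *s v) * cker r t) = dd f x v"
  using dd_cauchy[of S f r x v] assms unfolding box_real
  by (blast intro: has_integral_integrable integral_unique)+

lemma continuous_dd:
  assumes S: "open S" "\<And>y. y \<in> S \<Longrightarrow> cdiff f y"
  shows "continuous_on S (\<lambda>x. dd f x v)"
proof (rule continuous_at_imp_continuous_on, rule ballI)
  fix x0 assume "x0 \<in> S"
  obtain d r where dr: "d > 0" "r > 0" "\<And>x z. x \<in> ball x0 d \<Longrightarrow> cmod z \<le> r \<Longrightarrow> x + z *s v \<in> S"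
    using cdiff_ball_radius[OF S(1) \<open>x0 \<in> S\<close>, of v] by blast
  have cf: "continuous_on S f"
    using S(2) cdiff_isCont continuous_at_imp_continuous_on by blast
  let ?h = "\<lambda>x t. f (x + circ r t *s v)
            * cker r t"
  have "continuous_on (ball x0 d) (\<lambda>x. integral (cbox 0 1) (?h x))"
  proof (rule integral_continuous_on_param)
    show "continuous_on (ball x0 d \<times> cbox 0 1) (\<lambda>(x, t). ?h x t)"
      unfolding split_beta
      using dr by (intro continuous_intros continuous_on_compose2[OF cf]) auto
  qed
  moreover have "integral (cbox 0 1) (?h x) = dd f x v" if "x \<in> ball x0 d" for x
    using dd_cauchy_ball(2)[OF S dr(2,3) that] by simp
  ultimately have "continuous_on (ball x0 d) (\<lambda>x. dd f x v)"
    by (metis (no_types, lifting) continuous_on_cong)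
  then show "isCont (\<lambda>x. dd f x v) x0"
    using dr by (simp add: continuous_on_eq_continuous_at)
qed

text \<open>\<open>leibniz_rule\<close> asks for the derivative as a continuous family of bounded
  linear maps; in finite dimension the continuity in each direction, from
  \<open>continuous_dd\<close>, is enough.\<close>

lemma blinfun_dd:
  assumes S: "open S" "\<And>y. y \<in> S \<Longrightarrow> cdiff f y"
  shows "x \<in> S \<Longrightarrow> blinfun_apply (Blinfun (dd f x)) = dd f x"
    and "continuous_on S (\<lambda>x. Blinfun (dd f x))"
proof -
  show *: "blinfun_apply (Blinfun (dd f x)) = dd f x" if "x \<in> S" for x
    using S(2)[OF that] by (simp add: bounded_linear_Blinfun_apply cdiff_bounded_linear)
  show "continuous_on S (\<lambda>x. Blinfun (dd f x))"
    by (rule continuous_on_blinfun_componentwise)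
       (use continuous_dd[OF S] * in \<open>simp cong: continuous_on_cong\<close>)
qed

text \<open>Differentiation under the Cauchy integral: the derivative of
  \<open>\<lambda>x. dd f x v\<close> towards \<open>w\<close> is the integral of
  \<open>dd f (x0 + circ r t *s v) w\<close> against the kernel. Once
  \<open>\<lambda>x. dd f x w\<close> is known to be holomorphic on \<open>S\<close>, this integral
  is the Cauchy formula for its derivative in direction \<open>v\<close>, which gives the symmetry
  of mixed derivatives.\<close>

lemma dd_dd:
  assumes S: "open S" "\<And>y. y \<in> S \<Longrightarrow> cdiff f y" and "x0 \<in> S"
  shows "cdiff (\<lambda>x. dd f x v) x0" (is ?A)
    and "(\<And>y. y \<in> S \<Longrightarrow> cdiff (\<lambda>x. dd f x w) y) \<Longrightarrow> dd (\<lambda>x. dd f x v) x0 w = dd (\<lambda>x. dd f x w) x0 v"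
proof -
  obtain d r where dr: "d > 0" "r > 0" "\<And>x z. x \<in> ball x0 d \<Longrightarrow> cmod z \<le> r \<Longrightarrow> x + z *s v \<in> S"
    using cdiff_ball_radius[OF S(1) \<open>x0 \<in> S\<close>, of v] by blast
  have cf: "continuous_on S f"
    using S(2) cdiff_isCont continuous_at_imp_continuous_on by blast
  let ?e = "circ r"
  let ?k = "cker r"
  let ?h = "\<lambda>x t. f (x + ?e t *s v) * ?k t"
  let ?B = "\<lambda>x t. blinfun_mult_left (?k t) o\<^sub>L Blinfun (dd f (x + ?e t *s v))"
  have inS: "x + ?e t *s v \<in> S" if "x \<in> ball x0 d" for x t
    using dr that by auto
  have Bapp: "blinfun_apply (?B x t) w = dd f (x + ?e t *s v) w * ?k t" if "x \<in> ball x0 d" for x t w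
    using blinfun_dd(1)[OF S inS[OF that]] by simp
  have der: "((\<lambda>x. integral (cbox 0 1) (?h x)) has_derivative integral (cbox 0 1) (?B x0)) (at x0 within ball x0 d)"
  proof (rule leibniz_rule[where f="?h" and fx="?B"])
    fix x t assume x: "x \<in> ball x0 d"
    have 1: "((\<lambda>x. x + ?e t *s v) has_derivative (\<lambda>x. x)) (at x)"
      by (auto intro!: derivative_eq_intros)
    have "((\<lambda>x. ?h x t) has_derivative (\<lambda>w. dd f (x + ?e t *s v) w * ?k t)) (at x)"
      by (intro has_derivative_mult_left has_derivative_compose[OF 1] cdiff_has_derivative S inS x)
    then show "((\<lambda>x. ?h x t) has_derivative blinfun_apply (?B x t)) (at x within ball x0 d)"
      using Bapp[OF x] by (metis (no_types, lifting) ext has_derivative_at_withinI)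
  next
    fix x assume "x \<in> ball x0 d"
    then show "?h x integrable_on cbox 0 1"
      using dd_cauchy_ball(1)[OF S dr(2,3), of "ball x0 d" x] by simp
  next
    show "continuous_on (ball x0 d \<times> cbox 0 1) (\<lambda>(x, t). ?B x t)"
      unfolding split_beta
      using inS by (intro continuous_intros continuous_on_compose2[OF blinfun_dd(2)[OF S]]
          bounded_linear.continuous_on[OF bounded_linear_blinfun_mult_left]) (auto simp: dr)
  qed (use dr in auto)
  have Bint: "?B x0 integrable_on cbox 0 1"
    using inS by (intro integrable_continuous continuous_intros continuous_on_compose2[OF blinfun_dd(2)[OF S]]
          bounded_linear.continuous_on[OF bounded_linear_blinfun_mult_left]) (auto simp: dr)
  have "((\<lambda>x. integral (cbox 0 1) (?h x)) has_derivative integral (cbox 0 1) (?B x0)) (at x0)"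
    using der dr by (simp add: at_within_open[of _ "ball x0 d"])
  then have D: "((\<lambda>x. dd f x v) has_derivative integral (cbox 0 1) (?B x0)) (at x0)"
  proof (rule has_derivative_transform_within_open[of _ _ _ _ "ball x0 d"])
    show "integral (cbox 0 1) (?h x) = dd f x v" if "x \<in> ball x0 d" for x
      using dd_cauchy_ball(2)[OF S dr(2,3) that] by simp
  qed (use dr in auto)
  have I: "blinfun_apply (integral (cbox 0 1) (?B x0)) w = integral (cbox 0 1) (\<lambda>t. dd f (x0 + ?e t *s v) w * ?k t)" for w
    using blinfun_apply_integral[OF Bint, of w] Bapp[of x0] dr(1) by (simp del: blinfun_apply_blinfun_compose)
  show ?A
  proof (rule cdiffI[OF D])
    fix c w
    have "integral (cbox 0 1) (\<lambda>t. dd f (x0 + ?e t *s v) (c *s w) * ?k t) =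
      integral (cbox 0 1) (\<lambda>t. c * (dd f (x0 + ?e t *s v) w * ?k t))"
      by (intro integral_cong) (use S(2)[OF inS, of x0] dr in \<open>simp add: cdiff_dd_scale\<close>)
    then show "blinfun_apply (integral (cbox 0 1) (?B x0)) (c *s w) = c * blinfun_apply (integral (cbox 0 1) (?B x0)) w"
      unfolding I by simp
  qed
  show "dd (\<lambda>x. dd f x v) x0 w = dd (\<lambda>x. dd f x w) x0 v" if *: "\<And>y. y \<in> S \<Longrightarrow> cdiff (\<lambda>x. dd f x w) y"
  proof -
    have "integral (cbox 0 1) (\<lambda>t. dd f (x0 + ?e t *s v) w * ?k t) = dd (\<lambda>x. dd f x w) x0 v"
      using dd_cauchy_ball(2)[OF S(1) * dr(2,3), of "ball x0 d" x0] dr by simp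
    then show ?thesis
      using dd_eq[OF D] I by simp
  qed
qed

lemma cdiff_eventually_dd:
  assumes "eventually (cdiff f) (nhds x)"
  shows "eventually (cdiff (\<lambda>x. dd f x v)) (nhds x)"
    and "dd (\<lambda>x. dd f x v) x w = dd (\<lambda>x. dd f x w) x v"
proof -
  obtain S where S: "open S" "x \<in> S" "\<And>y. y \<in> S \<Longrightarrow> cdiff f y"
    using assms by (auto simp: eventually_nhds)
  show "eventually (cdiff (\<lambda>x. dd f x v)) (nhds x)"
    using S dd_dd(1)[OF S(1,3)] by (auto simp: eventually_nhds)
  show "dd (\<lambda>x. dd f x v) x w = dd (\<lambda>x. dd f x w) x v"
    using dd_dd(2)[OF S(1,3,2)] dd_dd(1)[OF S(1,3)] by blast
qed


section \<open>Functions holomorphic near a point\<close>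

abbreviation hol :: "(complex^'n \<Rightarrow> complex) \<Rightarrow> complex^'n \<Rightarrow> bool" where
  "hol f x \<equiv> eventually (cdiff f) (nhds x)"

lemma hol_cdiff: "hol f x \<Longrightarrow> cdiff f x"
  by (rule eventually_nhds_x_imp_x)

lemma has_derivative_eventually_cong:
  assumes "eventually (\<lambda>y. f y = g y) (nhds x)"
  shows "(f has_derivative D) (at x) \<longleftrightarrow> (g has_derivative D) (at x)"
proof -
  obtain S where "open S" "x \<in> S" "\<And>y. y \<in> S \<Longrightarrow> f y = g y"
    using assms by (auto simp: eventually_nhds)
  then show ?thesis
    using has_derivative_transform_within_open[of f D x UNIV S g] has_derivative_transform_within_open[of g D x UNIV S f] by auto
qed

lemma dd_cong: "eventually (\<lambda>y. f y = g y) (nhds x) \<Longrightarrow> dd f x = dd g x"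
  unfolding frechet_derivative_def by (simp add: has_derivative_eventually_cong)

lemma cdiff_cong: "eventually (\<lambda>y. f y = g y) (nhds x) \<Longrightarrow> cdiff f x \<longleftrightarrow> cdiff g x"
  unfolding cdiff_def by (simp add: has_derivative_eventually_cong)

lemma hol_cong:
  assumes "eventually (\<lambda>y. f y = g y) (nhds x)" "hol f x"
  shows "hol g x"
proof -
  \<comment> \<open>Agreement near \<open>x\<close> is agreement near every point close to
    \<open>x\<close>, so \<open>cdiff_cong\<close> applies at all of them.\<close>
  have "eventually (\<lambda>x. eventually (\<lambda>y. f y = g y) (nhds x)) (nhds x)"
    using assms(1) by (simp add: eventually_eventually)
  with assms(2) show ?thesis
    by eventually_elim (use cdiff_cong in blast)
qed

lemma dd_add_arg: "cdiff f x \<Longrightarrow> dd f x (u + v) = dd f x u + dd f x v"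
  using cdiff_bounded_linear linear_simps(1) by blast

lemma dd_diff_arg: "cdiff f x \<Longrightarrow> dd f x (u - v) = dd f x u - dd f x v"
  using cdiff_bounded_linear linear_simps(2) by blast

lemma dd_zero_arg [simp]: "cdiff f x \<Longrightarrow> dd f x 0 = 0"
  using cdiff_bounded_linear linear_simps(3) by blast

lemma dd_sum_arg: "cdiff f x \<Longrightarrow> dd f x (\<Sum>i\<in>I. u i) = (\<Sum>i\<in>I. dd f x (u i))"
  by (metis cdiff_bounded_linear bounded_linear.linear linear_sum)

lemma dd_expand:
  assumes "cdiff f x"
  shows "dd f x v = (\<Sum>i\<in>UNIV. v $ i * dd f x (axis i 1))"
proof -
  have "v = (\<Sum>i\<in>UNIV. v $ i *s axis i 1)"
    by (simp add: basis_expansion)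
  then show ?thesis
    by (metis (no_types, lifting) assms cdiff_dd_scale dd_sum_arg sum.cong)
qed

lemma cdiff_const [simp]: "cdiff (\<lambda>x. c) x" and dd_const [simp]: "dd (\<lambda>x. c) x v = 0"
  by (auto intro!: cdiffI derivative_eq_intros)

lemma
  assumes "cdiff f x" "cdiff g x"
  shows cdiff_add: "cdiff (\<lambda>x. f x + g x) x"
    and dd_add: "dd (\<lambda>x. f x + g x) x v = dd f x v + dd g x v"
    and cdiff_diff: "cdiff (\<lambda>x. f x - g x) x"
    and dd_diff: "dd (\<lambda>x. f x - g x) x v = dd f x v - dd g x v"
    and cdiff_mult: "cdiff (\<lambda>x. f x * g x) x"
    and dd_mult: "dd (\<lambda>x. f x * g x) x v = f x * dd g x v + dd f x v * g x"
proof -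
  note d = assms[THEN cdiff_has_derivative]
  note s = assms[THEN cdiff_dd_scale]
  show "cdiff (\<lambda>x. f x + g x) x" "cdiff (\<lambda>x. f x - g x) x" "cdiff (\<lambda>x. f x * g x) x"
    by (rule cdiffI[OF has_derivative_add[OF d]] cdiffI[OF has_derivative_diff[OF d]]
        cdiffI[OF has_derivative_mult[OF d]]; simp add: s algebra_simps)+
  show "dd (\<lambda>x. f x + g x) x v = dd f x v + dd g x v"
    "dd (\<lambda>x. f x - g x) x v = dd f x v - dd g x v"
    "dd (\<lambda>x. f x * g x) x v = f x * dd g x v + dd f x v * g x"
    using dd_eq[OF has_derivative_add[OF d]] dd_eq[OF has_derivative_diff[OF d]]
      dd_eq[OF has_derivative_mult[OF d]] by simp_all
qed

lemma cdiff_minus: "cdiff f x \<Longrightarrow> cdiff (\<lambda>x. - f x) x"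
  using cdiff_diff[OF cdiff_const, of f x 0] by simp

lemma dd_sum:
  assumes "\<And>i. i \<in> I \<Longrightarrow> cdiff (f i) x"
  shows "dd (\<lambda>x. \<Sum>i\<in>I. f i x) x v = (\<Sum>i\<in>I. dd (f i) x v)"
proof -
  have "cdiff (\<lambda>x. \<Sum>i\<in>I. f i x) x \<and> dd (\<lambda>x. \<Sum>i\<in>I. f i x) x v = (\<Sum>i\<in>I. dd (f i) x v)"
    using assms by (induction I rule: infinite_finite_induct) (auto simp: cdiff_add dd_add)
  then show ?thesis by simp
qed

lemma cdiff_inverse:
  assumes "cdiff f x" "f x \<noteq> 0"
  shows "cdiff (\<lambda>x. inverse (f x)) x"
  by (rule cdiffI[OF Deriv.has_derivative_inverse[OF assms(2) cdiff_has_derivative[OF assms(1)]]])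
     (simp add: cdiff_dd_scale[OF assms(1)])

lemma cdiff_coord [simp]: "cdiff (\<lambda>x. x $ i) x" and dd_coord [simp]: "dd (\<lambda>x. x $ i) x v = v $ i"
proof -
  have "((\<lambda>x. x $ i) has_derivative (\<lambda>x. x $ i)) (at x)"
    by (rule bounded_linear_imp_has_derivative[OF bounded_linear_vec_nth])
  then show "cdiff (\<lambda>x. x $ i) x" "dd (\<lambda>x. x $ i) x v = v $ i"
    using dd_eq[of "\<lambda>x. x $ i" "\<lambda>x. x $ i" x] by (auto intro: cdiffI)
qed

section \<open>Vector-valued maps and the chain rule\<close>

abbreviation vcdiff :: "(complex^'n \<Rightarrow> complex^'m) \<Rightarrow> complex^'n \<Rightarrow> bool" where
  "vcdiff F x \<equiv> \<forall>i. cdiff (\<lambda>y. F y $ i) x"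

definition vdd :: "(complex^'n \<Rightarrow> complex^'m) \<Rightarrow> complex^'n \<Rightarrow> complex^'n \<Rightarrow> complex^'m" where
  "vdd F x v = (\<chi> i. dd (\<lambda>y. F y $ i) x v)"

lemma vcdiff_has_derivative:
  fixes F :: "complex^'n \<Rightarrow> complex^'m"
  assumes "vcdiff F x" shows "(F has_derivative vdd F x) (at x)"
proof (rule iffD2[OF has_derivative_componentwise_within], rule ballI)
  \<comment> \<open>Derivatives are real here: the basis vectors are \<open>axis i u\<close> with
    \<open>u\<close> equal to 1 or \<open>\<i>\<close>, and the real component of \<open>F x\<close>
    is \<open>F x $ i \<bullet> u\<close>.\<close>
  fix b :: "complex^'m" assume "b \<in> Basis"
  then obtain i u where b: "b = axis i u" by (auto simp: Basis_vec_def)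
  have "((\<lambda>x. F x $ i \<bullet> u) has_derivative (\<lambda>v. dd (\<lambda>y. F y $ i) x v \<bullet> u)) (at x)"
    using assms by (intro has_derivative_inner_left cdiff_has_derivative) auto
  then show "((\<lambda>x. F x \<bullet> b) has_derivative (\<lambda>v. vdd F x v \<bullet> b)) (at x)"
    by (simp add: b inner_axis vdd_def)
qed

lemma vcdiff_isCont: "vcdiff F x \<Longrightarrow> isCont F x"
  using vcdiff_has_derivative has_derivative_continuous by blast

lemma vdd_scale: "vcdiff F x \<Longrightarrow> vdd F x (c *s v) = c *s vdd F x v"
  by (simp add: vdd_def vec_eq_iff cdiff_dd_scale)

lemma
  assumes "vcdiff F x" "cdiff f (F x)"
  shows cdiff_compose: "cdiff (\<lambda>x. f (F x)) x"
    and dd_compose: "dd (\<lambda>x. f (F x)) x v = dd f (F x) (vdd F x v)"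
proof -
  have d: "((\<lambda>x. f (F x)) has_derivative (\<lambda>v. dd f (F x) (vdd F x v))) (at x)"
    using has_derivative_compose[OF vcdiff_has_derivative cdiff_has_derivative] assms by blast
  show "cdiff (\<lambda>x. f (F x)) x"
    by (rule cdiffI[OF d]) (simp add: vdd_scale assms cdiff_dd_scale)
  show "dd (\<lambda>x. f (F x)) x v = dd f (F x) (vdd F x v)"
    using dd_eq[OF d] by simp
qed

lemma hol_compose:
  assumes "eventually (vcdiff F) (nhds x)" "hol f (F x)"
  shows "hol (\<lambda>x. f (F x)) x"
proof -
  have "filterlim F (nhds (F x)) (nhds x)"
    using vcdiff_isCont[of F x] assms(1) eventually_nhds_x_imp_x[of "vcdiff F" x]
    by (simp add: isCont_def tendsto_at_iff_tendsto_nhds)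
  then have "eventually (\<lambda>y. cdiff f (F y)) (nhds x)"
    using assms(2) by (auto simp: filterlim_iff)
  with assms(1) show ?thesis
    by eventually_elim (rule cdiff_compose)
qed

lemma hol_intros:
  "hol (\<lambda>x. c) x"
  "hol (\<lambda>x. x $ i) x"
  "hol f x \<Longrightarrow> hol g x \<Longrightarrow> hol (\<lambda>x. f x + g x) x"
  "hol f x \<Longrightarrow> hol g x \<Longrightarrow> hol (\<lambda>x. f x - g x) x"
  "hol f x \<Longrightarrow> hol g x \<Longrightarrow> hol (\<lambda>x. f x * g x) x"
  "hol f x \<Longrightarrow> hol (\<lambda>x. - f x) x"
proof -
  show "hol (\<lambda>x. c) x" by (intro always_eventually) simp
  show "hol (\<lambda>x. x $ i) x" by (intro always_eventually) simp
  show "hol (\<lambda>x. - f x) x" if "hol f x"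
    using that by eventually_elim (rule cdiff_minus)
  assume fg: "hol f x" "hol g x"
  show "hol (\<lambda>x. f x + g x) x" using fg by eventually_elim (rule cdiff_add)
  show "hol (\<lambda>x. f x - g x) x" using fg by eventually_elim (rule cdiff_diff)
  show "hol (\<lambda>x. f x * g x) x" using fg by eventually_elim (rule cdiff_mult)
qed

lemma hol_power: "hol f x \<Longrightarrow> hol (\<lambda>x. f x ^ k) x"
  by (induction k) (auto intro: hol_intros)

lemma hol_sum: "(\<And>i. i \<in> I \<Longrightarrow> hol (f i) x) \<Longrightarrow> hol (\<lambda>x. \<Sum>i\<in>I. f i x) x"
  by (induction I rule: infinite_finite_induct) (auto intro: hol_intros)

lemma hol_prod: "(\<And>i. i \<in> I \<Longrightarrow> hol (f i) x) \<Longrightarrow> hol (\<lambda>x. \<Prod>i\<in>I. f i x) x"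
  by (induction I rule: infinite_finite_induct) (auto intro: hol_intros)

lemma eventually_nonzero: "cdiff f x \<Longrightarrow> f x \<noteq> 0 \<Longrightarrow> eventually (\<lambda>y. f y \<noteq> 0) (nhds x)"
  using cdiff_isCont[of f x] tendsto_imp_eventually_ne[of f "f x" "nhds x" 0]
  by (simp add: isCont_def tendsto_at_iff_tendsto_nhds)

lemma hol_inverse:
  assumes "hol f x" "f x \<noteq> 0" shows "hol (\<lambda>x. inverse (f x)) x"
  using assms(1) eventually_nonzero[OF hol_cdiff[OF assms(1)] assms(2)]
  by eventually_elim (rule cdiff_inverse)

lemma hol_dd: "hol f x \<Longrightarrow> hol (\<lambda>x. dd f x v) x"
  by (rule cdiff_eventually_dd)

lemma dd_dd_commute: "hol f x \<Longrightarrow> dd (\<lambda>x. dd f x v) x w = dd (\<lambda>x. dd f x w) x v"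
  by (rule cdiff_eventually_dd)

section \<open>Action and bracket of vector fields\<close>

lemma vf_apply_expand:
  "cdiff f x \<Longrightarrow> vf_apply V f x = (\<Sum>i\<in>UNIV. V x $ i * dd f x (axis i 1))"
  by (simp add: vf_apply_def flip: dd_expand)

lemma hol_vf_apply:
  assumes "hol f x" "\<And>i. hol (\<lambda>x. V x $ i) x"
  shows "hol (vf_apply V f) x"
proof (rule hol_cong)
  show "\<forall>\<^sub>F y in nhds x. (\<Sum>i\<in>UNIV. V y $ i * dd f y (axis i 1)) = vf_apply V f y"
    using assms(1) by eventually_elim (simp add: vf_apply_expand)
  show "hol (\<lambda>y. \<Sum>i\<in>UNIV. V y $ i * dd f y (axis i 1)) x"
    using assms by (intro hol_sum hol_intros hol_dd)
qed

text \<open>Product rule for \<open>W f = \<Sum> W_i * \<partial>_i f\<close>; the symmetry of mixed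
  derivatives allows the second-order part to be written with \<open>v\<close> inside and
  \<open>W x\<close> outside.\<close>

lemma dd_vf_apply:
  assumes f: "hol f x" and W: "vcdiff W x"
  shows "dd (vf_apply W f) x v = dd f x (vdd W x v) + dd (\<lambda>y. dd f y v) x (W x)"
proof -
  have fe: "cdiff (\<lambda>y. dd f y e) x" for e
    using hol_cdiff[OF hol_dd[OF f]] .
  have "dd (vf_apply W f) x = dd (\<lambda>y. \<Sum>i\<in>UNIV. W y $ i * dd f y (axis i 1)) x"
    by (rule dd_cong, use f in eventually_elim) (simp add: vf_apply_expand)
  then have "dd (vf_apply W f) x v =
     (\<Sum>i\<in>UNIV. W x $ i * dd (\<lambda>y. dd f y (axis i 1)) x v + dd (\<lambda>y. W y $ i) x v * dd f x (axis i 1))"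
    using W fe by (simp add: dd_sum cdiff_mult dd_mult)
  also have "\<dots> = (\<Sum>i\<in>UNIV. W x $ i * dd (\<lambda>y. dd f y v) x (axis i 1)) + (\<Sum>i\<in>UNIV. vdd W x v $ i * dd f x (axis i 1))"
    by (subst dd_dd_commute[OF f]) (simp add: sum.distrib vdd_def)
  also have "\<dots> = dd (\<lambda>y. dd f y v) x (W x) + dd f x (vdd W x v)"
    using dd_expand[OF fe] dd_expand[OF hol_cdiff[OF f]] by metis
  finally show ?thesis by simp
qed

lemma vf_bracket_eq: "vf_bracket V W x = vdd W x (V x) - vdd V x (W x)"
  by (simp add: vf_bracket_def vdd_def vf_apply_def vec_eq_iff)

text \<open>The second-order terms of the two compositions are mixed derivatives in the directions
  \<open>V x\<close> and \<open>W x\<close>; they cancel by symmetry, and the first-order rest is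
  the bracket.\<close>

lemma vf_apply_bracket:
  assumes f: "hol f x" and "vcdiff V x" "vcdiff W x"
  shows "vf_apply (vf_bracket V W) f x = vf_apply V (vf_apply W f) x - vf_apply W (vf_apply V f) x"
proof -
  have "vf_apply V (vf_apply W f) x = dd f x (vdd W x (V x)) + dd (\<lambda>y. dd f y (V x)) x (W x)"
    "vf_apply W (vf_apply V f) x = dd f x (vdd V x (W x)) + dd (\<lambda>y. dd f y (W x)) x (V x)"
    using dd_vf_apply assms by (auto simp: vf_apply_def[of _ "vf_apply _ _"])
  then show ?thesis
    using dd_dd_commute[OF f] hol_cdiff[OF f]
    by (simp add: vf_bracket_eq vf_apply_def[of "vf_bracket V W"] dd_diff_arg)
qed

lemma vf_apply_mult:
  "cdiff f x \<Longrightarrow> cdiff g x \<Longrightarrow> vf_apply V (\<lambda>x. f x * g x) x = f x * vf_apply V g x + vf_apply V f x * g x"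
  by (simp add: vf_apply_def dd_mult)

lemma vf_apply_add:
  "cdiff f x \<Longrightarrow> cdiff g x \<Longrightarrow> vf_apply V (\<lambda>x. f x + g x) x = vf_apply V f x + vf_apply V g x"
  by (simp add: vf_apply_def dd_add)

lemma vf_apply_cong:
  "eventually (\<lambda>y. f y = g y) (nhds x) \<Longrightarrow> V x = W x \<Longrightarrow> vf_apply V f x = vf_apply W g x"
  using dd_cong[of f g x] by (simp add: vf_apply_def)

lemma vdd_smult:
  assumes "cdiff h x" "vcdiff W x"
  shows "vdd (\<lambda>x. h x *s W x) x v = h x *s vdd W x v + dd h x v *s W x"
  using assms by (simp add: vdd_def vec_eq_iff dd_mult)

lemma vf_bracket_smult_right:
  assumes "cdiff h x" "vcdiff V x" "vcdiff W x"
  shows "vf_bracket V (\<lambda>x. h x *s W x) x = vf_apply V h x *s W x + h x *s vf_bracket V W x"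
  using assms
  by (simp add: vf_bracket_eq vdd_smult vf_apply_def vdd_scale vector_ssub_ldistrib algebra_simps)

lemma vf_bracket_smult_left:
  assumes "cdiff h x" "vcdiff V x" "vcdiff W x"
  shows "vf_bracket (\<lambda>x. h x *s W x) V x = h x *s vf_bracket W V x - vf_apply V h x *s W x"
  using assms
  by (simp add: vf_bracket_eq vdd_smult vf_apply_def vdd_scale vector_ssub_ldistrib algebra_simps)

lemma vdd_add: "vcdiff V x \<Longrightarrow> vcdiff W x \<Longrightarrow> vdd (\<lambda>x. V x + W x) x v = vdd V x v + vdd W x v"
  by (simp add: vdd_def vec_eq_iff dd_add)

lemma vdd_add_arg: "vcdiff V x \<Longrightarrow> vdd V x (u + v) = vdd V x u + vdd V x v"
  by (simp add: vdd_def vec_eq_iff dd_add_arg)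

lemma vf_bracket_add_left:
  "vcdiff U x \<Longrightarrow> vcdiff V x \<Longrightarrow> vcdiff W x \<Longrightarrow>
   vf_bracket (\<lambda>x. U x + V x) W x = vf_bracket U W x + vf_bracket V W x"
  by (simp add: vf_bracket_eq vdd_add vdd_add_arg)

lemma vdd_cong: "eventually (\<lambda>y. V y = W y) (nhds x) \<Longrightarrow> vdd V x = vdd W x"
  unfolding vdd_def by (intro ext arg_cong[where f=vec_lambda] fun_cong[OF dd_cong]) (auto elim: eventually_mono)

lemma vf_bracket_cong:
  assumes "eventually (\<lambda>y. V y = V' y) (nhds x)" "eventually (\<lambda>y. W y = W' y) (nhds x)"
  shows "eventually (\<lambda>y. vf_bracket V W y = vf_bracket V' W' y) (nhds x)"
proof -
  have "eventually (\<lambda>z. eventually (\<lambda>y. V y = V' y) (nhds z)) (nhds x)"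
    "eventually (\<lambda>z. eventually (\<lambda>y. W y = W' y) (nhds z)) (nhds x)"
    using assms by (simp_all add: eventually_eventually)
  with assms show ?thesis
    by eventually_elim (simp add: vf_bracket_eq vdd_cong)
qed

subsection \<open>Germs at the origin\<close>

lemma hol_germ_iff: "hol_germ f \<longleftrightarrow> hol f 0"
  unfolding hol_germ_def holo_on_iff eventually_nhds by auto

lemma hol_vf_iff: "hol_vf V \<longleftrightarrow> (\<forall>i. hol (\<lambda>x. V x $ i) 0)"
proof
  assume "hol_vf V"
  then show "\<forall>i. hol (\<lambda>x. V x $ i) 0"
    unfolding hol_vf_def holo_vec_on_def holo_on_iff eventually_nhds by blast
next
  assume "\<forall>i. hol (\<lambda>x. V x $ i) 0"
  then have "\<forall>\<^sub>F x in nhds 0. vcdiff V x"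
    by (intro eventually_all_finite) auto
  then show "hol_vf V"
    unfolding hol_vf_def holo_vec_on_def holo_on_iff eventually_nhds by blast
qed

lemma hol_vf_vcdiff: "hol_vf V \<Longrightarrow> \<forall>\<^sub>F x in nhds 0. vcdiff V x"
  unfolding hol_vf_iff by (rule eventually_all_finite) auto

lemma hol_vf_hol: "hol_vf V \<Longrightarrow> \<forall>\<^sub>F x in nhds 0. \<forall>i. hol (\<lambda>x. V x $ i) x"
  unfolding hol_vf_iff by (rule eventually_all_finite) (auto simp: eventually_eventually)

lemma hol_vf_cong:
  assumes "eventually (\<lambda>x. V x = W x) (nhds 0)" "hol_vf V"
  shows "hol_vf W"
  unfolding hol_vf_iff
proof
  fix i
  have "eventually (\<lambda>x. V x $ i = W x $ i) (nhds 0)"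
    using assms(1) by eventually_elim simp
  then show "hol (\<lambda>x. W x $ i) 0"
    by (rule hol_cong) (use assms(2) in \<open>simp add: hol_vf_iff\<close>)
qed

lemma hol_vf_add: "hol_vf V \<Longrightarrow> hol_vf W \<Longrightarrow> hol_vf (\<lambda>x. V x + W x)"
  by (auto simp: hol_vf_iff intro!: hol_intros)

lemma hol_vf_diff: "hol_vf V \<Longrightarrow> hol_vf W \<Longrightarrow> hol_vf (\<lambda>x. V x - W x)"
  by (auto simp: hol_vf_iff intro!: hol_intros)

lemma hol_vf_smult: "hol h 0 \<Longrightarrow> hol_vf W \<Longrightarrow> hol_vf (\<lambda>x. h x *s W x)"
  by (auto simp: hol_vf_iff intro!: hol_intros)

lemma hol_vf_const: "hol_vf (\<lambda>x. c)"
  by (auto simp: hol_vf_iff intro!: hol_intros)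

lemma hol_vf_apply_germ: "hol_vf V \<Longrightarrow> hol f 0 \<Longrightarrow> hol (vf_apply V f) 0"
  by (auto simp: hol_vf_iff intro!: hol_vf_apply)

lemma hol_vf_bracket: "hol_vf V \<Longrightarrow> hol_vf W \<Longrightarrow> hol_vf (vf_bracket V W)"
  by (auto simp: hol_vf_iff vf_bracket_def intro!: hol_intros hol_vf_apply)

lemma vf_apply_germ_cong:
  assumes "eventually (\<lambda>x. V x = W x) (nhds 0)" "eventually (\<lambda>x. f x = g x) (nhds 0)"
  shows "eventually (\<lambda>x. vf_apply V f x = vf_apply W g x) (nhds 0)"
proof -
  have "eventually (\<lambda>x. eventually (\<lambda>y. f y = g y) (nhds x)) (nhds 0)"
    using assms(2) by (simp add: eventually_eventually)
  with assms(1) show ?thesis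
    by eventually_elim (rule vf_apply_cong)
qed

lemma vf_germ_cong: "eventually (\<lambda>x. V x = W x) (nhds 0) \<Longrightarrow> vf_germ V = vf_germ W"
proof -
  assume *: "eventually (\<lambda>x. V x = W x) (nhds 0)"
  have "(\<forall>\<^sub>F x in nhds 0. U x = V x) \<longleftrightarrow> (\<forall>\<^sub>F x in nhds 0. U x = W x)" for U
    by (rule eventually_subst) (use * in eventually_elim, simp)
  then show ?thesis by (simp add: vf_germ_def)
qed

lemma vf_germ_eq_iff:
  assumes "hol_vf V"
  shows "vf_germ V = vf_germ W \<longleftrightarrow> eventually (\<lambda>x. V x = W x) (nhds 0)"
proof
  assume "vf_germ V = vf_germ W"
  moreover have "V \<in> vf_germ V" using assms by (simp add: vf_germ_def)
  ultimately show "eventually (\<lambda>x. V x = W x) (nhds 0)" by (auto simp: vf_germ_def)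
qed (rule vf_germ_cong)

lemma rep_germ:
  assumes "hol_vf V"
  shows "eventually (\<lambda>x. rep (vf_germ V) x = V x) (nhds 0)"
proof -
  have "V \<in> vf_germ V" using assms by (simp add: vf_germ_def)
  then have "rep (vf_germ V) \<in> vf_germ V" unfolding rep_def by (rule someI[where P="\<lambda>W. W \<in> vf_germ V"])
  then show ?thesis by (simp add: vf_germ_def)
qed

lemma gadd_germ:
  assumes "hol_vf V" "hol_vf W"
  shows "gadd (vf_germ V) (vf_germ W) = vf_germ (\<lambda>x. V x + W x)"
  unfolding gadd_def by (rule vf_germ_cong, use assms[THEN rep_germ] in eventually_elim) simp

lemma gscale_germ:
  assumes "hol_vf V"
  shows "gscale c (vf_germ V) = vf_germ (\<lambda>x. c *s V x)"
  unfolding gscale_def by (rule vf_germ_cong, use rep_germ[OF assms] in eventually_elim) simp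

lemma gbr_germ: "hol_vf V \<Longrightarrow> hol_vf W \<Longrightarrow> gbr (vf_germ V) (vf_germ W) = vf_germ (vf_bracket V W)"
  unfolding gbr_def by (intro vf_germ_cong vf_bracket_cong rep_germ)

text \<open>Trading a set of germs for all its representatives makes \<open>rep\<close> disappear:
  by \<open>reps_cong\<close> membership depends only on the germ, and the Lie operations become
  operations on functions.\<close>

definition reps :: "(complex^'n \<Rightarrow> complex^'n) set set \<Rightarrow> (complex^'n \<Rightarrow> complex^'n) set" where
  "reps A = {V. hol_vf V \<and> vf_germ V \<in> A}"

lemma reps_Der: "reps Der = Collect hol_vf"
  by (auto simp: reps_def Der_def)

lemma germs_eq_reps: "A \<subseteq> Der \<Longrightarrow> A = vf_germ ` reps A"
  by (auto simp: reps_def Der_def)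

lemma ball_germs: "A \<subseteq> Der \<Longrightarrow> (\<forall>a\<in>A. P a) \<longleftrightarrow> (\<forall>V\<in>reps A. P (vf_germ V))"
  unfolding reps_def Der_def by blast

lemma reps_mono_iff: "A \<subseteq> Der \<Longrightarrow> A \<subseteq> B \<longleftrightarrow> reps A \<subseteq> reps B"
  unfolding reps_def Der_def by blast

lemma reps_hol: "V \<in> reps A \<Longrightarrow> hol_vf V"
  by (simp add: reps_def)

lemma reps_cong: "V \<in> reps A \<Longrightarrow> eventually (\<lambda>x. V x = W x) (nhds 0) \<Longrightarrow> W \<in> reps A"
  unfolding reps_def using vf_germ_cong[of V W] hol_vf_cong[of V W] by auto

lemma lie_subalg_iff:
  assumes "A \<subseteq> Der"
  shows "lie_subalg A \<longleftrightarrow> (\<lambda>x. 0) \<in> reps A \<and>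
     (\<forall>V\<in>reps A. \<forall>W\<in>reps A. (\<lambda>x. V x + W x) \<in> reps A) \<and>
     (\<forall>c. \<forall>V\<in>reps A. (\<lambda>x. c *s V x) \<in> reps A) \<and>
     (\<forall>V\<in>reps A. \<forall>W\<in>reps A. vf_bracket V W \<in> reps A)"
proof -
  have "gzero \<in> A \<longleftrightarrow> (\<lambda>x. 0) \<in> reps A"
    by (simp add: gzero_def reps_def hol_vf_const)
  moreover have "gadd (vf_germ V) (vf_germ W) \<in> A \<longleftrightarrow> (\<lambda>x. V x + W x) \<in> reps A"
    "gscale c (vf_germ V) \<in> A \<longleftrightarrow> (\<lambda>x. c *s V x) \<in> reps A"
    "gbr (vf_germ V) (vf_germ W) \<in> A \<longleftrightarrow> vf_bracket V W \<in> reps A" if "V \<in> reps A" "W \<in> reps A" for V W c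
    using that by (simp_all add: reps_def gadd_germ gscale_germ gbr_germ hol_vf_add hol_vf_bracket
        hol_vf_smult hol_intros)
  ultimately show ?thesis
    using assms unfolding lie_subalg_def by (simp add: ball_germs)
qed

lemma
  assumes "lie_subalg A"
  shows lie_add: "V \<in> reps A \<Longrightarrow> W \<in> reps A \<Longrightarrow> (\<lambda>x. V x + W x) \<in> reps A"
    and lie_scale: "V \<in> reps A \<Longrightarrow> (\<lambda>x. c *s V x) \<in> reps A"
    and lie_bracket: "V \<in> reps A \<Longrightarrow> W \<in> reps A \<Longrightarrow> vf_bracket V W \<in> reps A"
  using assms lie_subalg_iff[of A] by (auto simp: lie_subalg_def)

lemma lie_minus: "lie_subalg A \<Longrightarrow> V \<in> reps A \<Longrightarrow> (\<lambda>x. - V x) \<in> reps A"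
  using lie_scale[of A V "-1"] by (simp flip: vector_sneg_minus1)

lemma lie_ideal_iff:
  "lie_ideal_in I Der \<longleftrightarrow> lie_subalg I \<and> (\<forall>V\<in>reps I. \<forall>W. hol_vf W \<longrightarrow> vf_bracket V W \<in> reps I)"
proof -
  have "gbr (vf_germ V) (vf_germ W) \<in> I \<longleftrightarrow> vf_bracket V W \<in> reps I" if "hol_vf V" "hol_vf W" for V W
    using that by (simp add: reps_def gbr_germ hol_vf_bracket)
  then have "(\<forall>i\<in>I. \<forall>b\<in>Der. gbr i b \<in> I) \<longleftrightarrow> (\<forall>V\<in>reps I. \<forall>W. hol_vf W \<longrightarrow> vf_bracket V W \<in> reps I)"
    if "I \<subseteq> Der"
    using that by (simp add: ball_germs ball_germs[OF subset_refl] reps_Der reps_hol)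
  moreover have "lie_subalg I \<Longrightarrow> I \<subseteq> Der"
    by (simp add: lie_subalg_def)
  ultimately show ?thesis
    unfolding lie_ideal_in_def by (cases "lie_subalg I") simp_all
qed

lemma zero_germ_iff: "hol_vf V \<Longrightarrow> vf_germ V = gzero \<longleftrightarrow> eventually (\<lambda>x. V x = 0) (nhds 0)"
  by (simp add: gzero_def vf_germ_eq_iff)

lemma lie_subalg_Der: "lie_subalg Der"
  by (subst lie_subalg_iff) (auto simp: reps_Der hol_vf_const hol_vf_add hol_vf_smult hol_intros hol_vf_bracket)


subsection \<open>Jacobian determinants\<close>

text \<open>The factor of the replaced row is split off from each permutation term, in the shape
  that the product rule produces in \<open>det_has_derivative\<close>.\<close>

lemma det_replace_row:
  fixes A :: "'a::comm_ring_1^'n^'n"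
  shows "det (\<chi> k. if k = i then r else A $ k) =
    (\<Sum>p | p permutes UNIV. of_int (sign p) * (r $ p i * (\<Prod>k\<in>UNIV - {i}. A $ k $ p k)))"
proof -
  have "(\<Prod>k\<in>UNIV. (\<chi> k. if k = i then r else A $ k) $ k $ p k) = r $ p i * (\<Prod>k\<in>UNIV - {i}. A $ k $ p k)" for p
    by (subst prod.remove[of _ i]) auto
  then show ?thesis
    unfolding det_def by simp
qed

text \<open>The product rule in each permutation term, with the terms regrouped by the row that is
  differentiated.\<close>

lemma det_has_derivative:
  fixes M :: "'b::real_normed_vector \<Rightarrow> complex^'n^'n"
  assumes "\<And>i j. ((\<lambda>x. M x $ i $ j) has_derivative D i j) (at x)"
  shows "((\<lambda>x. det (M x)) has_derivative
    (\<lambda>v. \<Sum>i\<in>UNIV. det (\<chi> k. if k = i then (\<chi> j. D i j v) else M x $ k))) (at x)"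
proof -
  have "((\<lambda>x. \<Sum>p | p permutes (UNIV::'n set). of_int (sign p) * (\<Prod>k\<in>UNIV. M x $ k $ p k)) has_derivative
    (\<lambda>v. \<Sum>p | p permutes (UNIV::'n set). of_int (sign p) * (\<Sum>i\<in>UNIV. D i (p i) v * (\<Prod>k\<in>UNIV - {i}. M x $ k $ p k)))) (at x)"
    by (intro has_derivative_sum has_derivative_mult_right has_derivative_prod assms)
  moreover have "(\<Sum>p | p permutes (UNIV::'n set). of_int (sign p) * (\<Sum>i\<in>UNIV. D i (p i) v * (\<Prod>k\<in>UNIV - {i}. M x $ k $ p k)))
     = (\<Sum>i\<in>UNIV. det (\<chi> k. if k = i then (\<chi> j. D i j v) else M x $ k))" for v
    unfolding det_replace_row sum_distrib_left by (subst sum.swap) simp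
  ultimately show ?thesis
    by (simp add: det_def)
qed

lemma dd_det:
  fixes M :: "complex^'m \<Rightarrow> complex^'n^'n"
  assumes "\<And>i j. cdiff (\<lambda>x. M x $ i $ j) x"
  shows "dd (\<lambda>x. det (M x)) x v =
      (\<Sum>i\<in>UNIV. det (\<chi> k. if k = i then (\<chi> j. dd (\<lambda>x. M x $ i $ j) x v) else M x $ k))"
  using dd_eq[OF det_has_derivative[OF cdiff_has_derivative[OF assms]]] by simp

lemma hol_det:
  fixes M :: "complex^'m \<Rightarrow> complex^'n^'n"
  assumes "\<And>i j. hol (\<lambda>x. M x $ i $ j) x"
  shows "hol (\<lambda>x. det (M x)) x"
  unfolding det_def by (intro hol_sum hol_intros hol_prod assms)

text \<open>Both sides are the derivative of \<open>det (A (1 + t N))\<close> at \<open>t = 0\<close>.\<close>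

lemma sum_det_replace_row_mult:
  fixes A N :: "complex^'n^'n"
  shows "(\<Sum>i\<in>UNIV. det (\<chi> k. if k = i then (A ** N) $ i else A $ k)) =
    (\<Sum>i\<in>UNIV. det (\<chi> k. if k = i then N $ i else mat 1 $ k)) * det A"
proof -
  have 1: "((\<lambda>t::complex. det (\<chi> i j. A $ i $ j + t * (A ** N) $ i $ j)) has_derivative
    (\<lambda>v. \<Sum>i\<in>UNIV. det (\<chi> k. if k = i then (\<chi> j. v * (A ** N) $ i $ j) else (\<chi> i j. A $ i $ j + 0 * (A ** N) $ i $ j) $ k))) (at 0)"
    by (rule det_has_derivative) (auto intro!: derivative_eq_intros)
  have "((\<lambda>t::complex. det (\<chi> i j. mat 1 $ i $ j + t * N $ i $ j)) has_derivative
    (\<lambda>v. \<Sum>i\<in>UNIV. det (\<chi> k. if k = i then (\<chi> j. v * N $ i $ j) else (\<chi> i j. mat 1 $ i $ j + 0 * N $ i $ j) $ k))) (at 0)"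
    by (rule det_has_derivative) (auto intro!: derivative_eq_intros)
  then have 2: "((\<lambda>t::complex. det A * det (\<chi> i j. mat 1 $ i $ j + t * N $ i $ j)) has_derivative
    (\<lambda>v. det A * (\<Sum>i\<in>UNIV. det (\<chi> k. if k = i then (\<chi> j. v * N $ i $ j) else (\<chi> i j. mat 1 $ i $ j + 0 * N $ i $ j) $ k)))) (at 0)"
    by (rule has_derivative_mult_right)
  have "det (\<chi> i j. A $ i $ j + t * (A ** N) $ i $ j) = det A * det (\<chi> i j. mat 1 $ i $ j + t * N $ i $ j)" for t
  proof -
    have "(A ** (\<chi> i j. mat 1 $ i $ j + t * N $ i $ j)) $ i $ j = (A ** mat 1) $ i $ j + t * (A ** N) $ i $ j" for i j
      by (simp add: matrix_matrix_mult_def distrib_left sum.distrib sum_distrib_left mult.left_commute del: matrix_mul_rid)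
    then have "(\<chi> i j. A $ i $ j + t * (A ** N) $ i $ j) = A ** (\<chi> i j. mat 1 $ i $ j + t * N $ i $ j)"
      by (simp add: vec_eq_iff)
    then show ?thesis by (simp add: det_mul)
  qed
  from has_derivative_unique[OF 1[unfolded this] 2, THEN fun_cong, of 1]
  show ?thesis
    by (simp add: vec_lambda_eta mult.commute cong: if_cong)
qed

section \<open>The Jacobian determinant along a vector field\<close>

definition jmat :: "('n \<Rightarrow> complex^'n \<Rightarrow> complex) \<Rightarrow> complex^'n \<Rightarrow> complex^'n^'n" where
  "jmat g x = (\<chi> i j. dd (g i) x (axis j 1))"

definition jac :: "('n \<Rightarrow> complex^'n \<Rightarrow> complex) \<Rightarrow> complex^'n \<Rightarrow> complex" where
  "jac g x = det (jmat g x)"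

lemma hol_jac: "(\<And>i. hol (g i) x) \<Longrightarrow> hol (jac g) x"
  unfolding jac_def by (rule hol_det) (simp add: jmat_def hol_dd)

text \<open>The usual divergence \<open>\<Sum> \<partial>_i V_i\<close>: replacing row
  \<open>i\<close> of the identity leaves the diagonal entry as determinant. In this form it is the
  factor that \<open>sum_det_replace_row_mult\<close> yields for the derivative matrix of
  \<open>V\<close>.\<close>

definition div_vf :: "(complex^'n \<Rightarrow> complex^'n) \<Rightarrow> complex^'n \<Rightarrow> complex" where
  "div_vf V x = (\<Sum>i\<in>UNIV. det (\<chi> k. if k = i then (\<chi> j. dd (\<lambda>y. V y $ i) x (axis j 1)) else mat 1 $ k))"

lemma hol_div_vf:
  assumes "\<And>i. hol (\<lambda>x. V x $ i) x"
  shows "hol (div_vf V) x"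
proof -
  have "hol (\<lambda>x. (\<chi> k. if k = i then (\<chi> j. dd (\<lambda>y. V y $ i) x (axis j 1)) else mat 1 $ k) $ k $ j) x" for i k j
    using assms[of i] by (cases "k = i") (auto intro!: hol_dd hol_intros)
  then show ?thesis
    unfolding div_vf_def by (intro hol_sum hol_det)
qed

text \<open>In \<open>jac (g(i := vf_apply V (g i)))\<close> the new row is the sum of a row of
  \<open>jmat g x ** N\<close>, where \<open>N\<close> is the derivative of \<open>V\<close>, and of
  \<open>H i\<close>, the derivative of row \<open>i\<close> along \<open>V\<close>. Summed over
  \<open>i\<close>, the \<open>H\<close> parts give the derivative of the determinant and the others
  the divergence times \<open>jac g\<close>. This is the Lie derivative of the form
  \<open>dg_1 \<and> ... \<and> dg_n\<close> written with functions.\<close>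

lemma vf_apply_jac:
  assumes g: "\<And>i. hol (g i) x" and V: "vcdiff V x"
  shows "vf_apply V (jac g) x = (\<Sum>i\<in>UNIV. jac (g(i := vf_apply V (g i))) x) - div_vf V x * jac g x"
proof -
  define N where "N = (\<chi> k j. dd (\<lambda>y. V y $ k) x (axis j 1))"
  let ?A = "jmat g x"
  define H where "H = (\<lambda>i. \<chi> j. dd (\<lambda>y. dd (g i) y (axis j 1)) x (V x))"
  have ge: "cdiff (\<lambda>y. dd (g i) y e) x" for i e
    using hol_cdiff[OF hol_dd[OF g]] .
  have row: "(\<chi> j. dd (vf_apply V (g i)) x (axis j 1)) = (?A ** N) $ i + H i" for i
  proof -
    have "dd (g i) x (vdd V x (axis j 1)) = (?A ** N) $ i $ j" for j
      by (subst dd_expand[OF hol_cdiff[OF g]])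
         (simp add: matrix_matrix_mult_def N_def jmat_def vdd_def mult.commute)
    then show ?thesis
      by (simp add: vec_eq_iff dd_vf_apply[OF g V] H_def)
  qed
  have upd: "jmat (g(i := vf_apply V (g i))) x = (\<chi> k. if k = i then (?A ** N) $ i + H i else ?A $ k)" for i
    unfolding row[symmetric] by (simp add: vec_eq_iff jmat_def)
  have J: "jac (g(i := vf_apply V (g i))) x =
     det (\<chi> k. if k = i then (?A ** N) $ i else ?A $ k) + det (\<chi> k. if k = i then H i else ?A $ k)" for i
    unfolding jac_def upd by (rule det_row_add)
  have "vf_apply V (jac g) x = (\<Sum>i\<in>UNIV. det (\<chi> k. if k = i then H i else ?A $ k))"
  proof -
    have "cdiff (\<lambda>x. jmat g x $ i $ j) x" "dd (\<lambda>x. jmat g x $ i $ j) x (V x) = H i $ j" for i j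
      by (simp_all add: jmat_def ge H_def)
    then show ?thesis
      unfolding vf_apply_def jac_def by (subst dd_det) (simp_all add: vec_lambda_eta cong: if_cong)
  qed
  moreover have "(\<Sum>i\<in>UNIV. det (\<chi> k. if k = i then (?A ** N) $ i else ?A $ k)) = div_vf V x * jac g x"
    unfolding sum_det_replace_row_mult by (simp add: div_vf_def N_def jac_def cong: if_cong)
  ultimately show ?thesis
    by (simp add: J sum.distrib)
qed

text \<open>Cramer's rule: \<open>df\<close> is a combination of the independent
  \<open>dg_i\<close>, and evaluation at \<open>u\<close>, dual to \<open>dg_k\<close>, reads off
  its \<open>k\<close>-th coefficient. Thus coordinate derivatives are quotients of Jacobian
  determinants.\<close>

lemma jac_update:
  assumes "cdiff f x" "\<And>i. cdiff (g i) x"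
    and u: "\<And>i. dd (g i) x u = (if i = k then 1 else 0)" and nz: "jac g x \<noteq> 0"
  shows "jac (g(k := f)) x = dd f x u * jac g x"
proof -
  let ?A = "jmat g x"
  define d where "d = (\<chi> j. dd f x (axis j 1))"
  have "invertible ?A" using nz by (simp add: jac_def invertible_det_nz)
  then obtain B where B: "B ** ?A = mat 1" "?A ** B = mat 1" by (auto simp: invertible_def)
  define c where "c = d v* B"
  have "c v* ?A = d" by (simp add: c_def vector_matrix_mul_assoc B)
  then have d: "d = (\<Sum>i\<in>UNIV. c $ i *s row i ?A)"
    by (auto simp: vec_eq_iff vector_matrix_mult_def row_def mult.commute)
  have "dd f x u = (\<Sum>j\<in>UNIV. u $ j * d $ j)"
    by (subst dd_expand[OF assms(1)]) (simp add: d_def)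
  also have "\<dots> = (\<Sum>j\<in>UNIV. \<Sum>i\<in>UNIV. u $ j * (c $ i * ?A $ i $ j))"
    by (subst d) (simp add: row_def sum_distrib_left)
  also have "\<dots> = (\<Sum>i\<in>UNIV. c $ i * (\<Sum>j\<in>UNIV. u $ j * ?A $ i $ j))"
    by (subst sum.swap) (simp add: sum_distrib_left mult.left_commute)
  also have "\<dots> = (\<Sum>i\<in>UNIV. c $ i * dd (g i) x u)"
    by (simp only: dd_expand[OF assms(2), of _ u] jmat_def vec_lambda_beta)
  also have "\<dots> = c $ k" by (simp add: u if_distrib[of "\<lambda>z. _ * z"] cong: if_cong)
  finally have ck: "dd f x u = c $ k" .
  have "jmat (g(k := f)) x = (\<chi> i. if i = k then (\<Sum>i\<in>UNIV. c $ i *s row i ?A) else row i ?A)"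
    unfolding d[symmetric] by (simp add: vec_eq_iff jmat_def d_def row_def)
  then show ?thesis
    unfolding ck jac_def by (simp only: cramer_lemma_transpose)
qed

subsection \<open>The ideal of the orbit of the origin\<close>

text \<open>The ideal of germs generated by \<open>T\<close>. Rule \<open>cong\<close> is there
  because the elements are functions, which a germ determines only near the origin.\<close>

inductive_set ospan :: "(complex^'n \<Rightarrow> complex) set \<Rightarrow> (complex^'n \<Rightarrow> complex) set" for T where
  zero: "(\<lambda>x. 0) \<in> ospan T"
| step: "s \<in> ospan T \<Longrightarrow> f \<in> T \<Longrightarrow> hol u 0 \<Longrightarrow> (\<lambda>x. u x * f x + s x) \<in> ospan T"
| cong: "s \<in> ospan T \<Longrightarrow> eventually (\<lambda>x. s x = s' x) (nhds 0) \<Longrightarrow> s' \<in> ospan T"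

lemma ospan_mult_base: "f \<in> T \<Longrightarrow> hol u 0 \<Longrightarrow> (\<lambda>x. u x * f x) \<in> ospan T"
  using ospan.step[OF ospan.zero] by simp

lemma ospan_base: "f \<in> T \<Longrightarrow> f \<in> ospan T"
  using ospan_mult_base[OF _ hol_intros(1)[of 1]] by simp

lemma ospan_add:
  assumes "s \<in> ospan T" "t \<in> ospan T"
  shows "(\<lambda>x. s x + t x) \<in> ospan T"
  using assms(1)
proof induction
  case zero
  then show ?case using assms(2) by simp
next
  case (step s f u)
  then show ?case using ospan.step[OF step.IH step.hyps(2,3)] by (simp add: add.assoc)
next
  case (cong s s')
  from cong.hyps(2) have "eventually (\<lambda>x. s x + t x = s' x + t x) (nhds 0)"
    by eventually_elim simp
  then show ?case by (rule ospan.cong[OF cong.IH])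
qed

lemma ospan_mult:
  assumes "s \<in> ospan T" "hol u 0"
  shows "(\<lambda>x. u x * s x) \<in> ospan T"
  using assms(1)
proof induction
  case zero
  then show ?case by (simp add: ospan.zero)
next
  case (step s f w)
  then show ?case using ospan.step[OF step.IH step.hyps(2) hol_intros(5)[OF assms(2) step.hyps(3)]]
    by (simp add: algebra_simps)
next
  case (cong s s')
  from cong.hyps(2) have "eventually (\<lambda>x. u x * s x = u x * s' x) (nhds 0)"
    by eventually_elim simp
  then show ?case by (rule ospan.cong[OF cong.IH])
qed

lemma ospan_sum:
  "(\<And>i. i \<in> I \<Longrightarrow> s i \<in> ospan T) \<Longrightarrow> (\<lambda>x. \<Sum>i\<in>I. s i x) \<in> ospan T"
  by (induction I rule: infinite_finite_induct) (auto intro: ospan.zero ospan_add)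

lemma ospan_hol:
  assumes "s \<in> ospan T" "\<And>f. f \<in> T \<Longrightarrow> hol f 0"
  shows "hol s 0"
  using assms(1)
proof induction
  case zero
  show ?case by (rule hol_intros)
next
  case (step s f u)
  then show ?case using assms(2) by (intro hol_intros) auto
next
  case (cong s s')
  then show ?case using hol_cong by blast
qed

lemma ospan_at_0:
  assumes "s \<in> ospan T" "\<And>f. f \<in> T \<Longrightarrow> f 0 = 0"
  shows "s 0 = 0"
  using assms(1) by induction (auto simp: assms(2) dest: eventually_nhds_x_imp_x)

text \<open>The largest ideal of germs that vanish at the origin and is stable under \<open>R\<close>;
  it plays the role of the ideal of the orbit of the origin under the flows of \<open>R\<close>.\<close>

definition orbit_ideal :: "(complex^'n \<Rightarrow> complex^'n) set \<Rightarrow> (complex^'n \<Rightarrow> complex) set" where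
  "orbit_ideal R = \<Union>{Q. \<forall>f\<in>Q. hol f 0 \<and> f 0 = 0 \<and> (\<forall>V\<in>R. vf_apply V f \<in> Q)}"

lemma orbit_idealD:
  assumes "f \<in> orbit_ideal R"
  shows "hol f 0" "f 0 = 0" "V \<in> R \<Longrightarrow> vf_apply V f \<in> orbit_ideal R"
  using assms unfolding orbit_ideal_def by blast+

lemma orbit_ideal_coinduct:
  assumes "\<And>f. f \<in> Q \<Longrightarrow> hol f 0" "\<And>f. f \<in> Q \<Longrightarrow> f 0 = 0" "\<And>f V. f \<in> Q \<Longrightarrow> V \<in> R \<Longrightarrow> vf_apply V f \<in> Q"
  shows "Q \<subseteq> orbit_ideal R"
  unfolding orbit_ideal_def by (intro Union_upper) (simp add: assms)

text \<open>By the product rule \<open>V (u * f + s) = V u * f + u * V f + V s\<close>, so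
  \<open>ospan T\<close> is a stable set as soon as the generators are mapped into it.\<close>

lemma ospan_subset_orbit_ideal:
  assumes T: "\<And>f. f \<in> T \<Longrightarrow> hol f 0" "\<And>f. f \<in> T \<Longrightarrow> f 0 = 0"
    and stable: "\<And>f V. f \<in> T \<Longrightarrow> V \<in> R \<Longrightarrow> vf_apply V f \<in> ospan T"
    and R: "\<And>V. V \<in> R \<Longrightarrow> hol_vf V"
  shows "ospan T \<subseteq> orbit_ideal R"
proof (rule orbit_ideal_coinduct)
  fix s V assume "s \<in> ospan T" "V \<in> R"
  from this(1) show "vf_apply V s \<in> ospan T"
  proof induction
    case zero
    have "vf_apply V (\<lambda>x. 0) = (\<lambda>x. 0)" by (simp add: vf_apply_def fun_eq_iff)
    then show ?case by (simp add: ospan.zero)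
  next
    case (step s f u)
    note f = T(1)[OF step.hyps(2)]
    have s: "hol s 0" using ospan_hol[OF step.hyps(1)] T(1) by blast
    have "(\<lambda>x. (vf_apply V u x * f x + u x * vf_apply V f x) + vf_apply V s x) \<in> ospan T"
      by (intro ospan_add step.IH ospan_mult_base ospan_mult stable hol_vf_apply_germ R step.hyps f \<open>V \<in> R\<close>)
    moreover have "eventually (\<lambda>x. (vf_apply V u x * f x + u x * vf_apply V f x) + vf_apply V s x = vf_apply V (\<lambda>x. u x * f x + s x) x) (nhds 0)"
      using f s step.hyps(3) by eventually_elim (simp add: vf_apply_add vf_apply_mult cdiff_mult)
    ultimately show ?case by (rule ospan.cong)
  next
    case (cong s s')
    from cong.hyps(2) have "eventually (\<lambda>x. vf_apply V s x = vf_apply V s' x) (nhds 0)"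
      by (intro vf_apply_germ_cong) auto
    then show ?case by (rule ospan.cong[OF cong.IH])
  qed
qed (simp_all add: ospan_hol ospan_at_0 T)

text \<open>The definition of \<open>orbit_ideal\<close> speaks of stable sets and not of ideals.
  Since the span of a stable set of this kind is again one, the largest such set contains its own
  span.\<close>

lemma ospan_orbit_ideal:
  assumes "\<And>V. V \<in> R \<Longrightarrow> hol_vf V" "s \<in> ospan (orbit_ideal R)"
  shows "s \<in> orbit_ideal R"
proof -
  have "ospan (orbit_ideal R) \<subseteq> orbit_ideal R"
    by (rule ospan_subset_orbit_ideal) (simp_all add: orbit_idealD ospan_base assms(1))
  then show ?thesis using assms(2) by blast
qed


subsection \<open>Charts\<close>

lemma higher_deriv_sequence:
  assumes "open B" "\<And>m t. t \<in> B \<Longrightarrow> (k m has_field_derivative k (Suc m) t) (at t)" "t \<in> B"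
  shows "(deriv ^^ m) (k 0) t = k m t"
  using assms(3)
proof (induction m arbitrary: t)
  case (Suc m)
  have "eventually (\<lambda>z. z \<in> B) (nhds t)"
    using assms(1) Suc.prems by (rule eventually_nhds_in_open)
  then have "eventually (\<lambda>z. (deriv ^^ m) (k 0) z = k m z) (nhds t)"
    by eventually_elim (rule Suc.IH)
  then have "deriv ((deriv ^^ m) (k 0)) t = deriv (k m) t"
    by (intro deriv_cong_ev) auto
  also have "\<dots> = k (Suc m) t"
    using assms(2)[OF Suc.prems] by (rule DERIV_imp_deriv)
  finally show ?case by simp
qed simp

text \<open>The hypothesis on \<open>E\<close> makes \<open>t \<mapsto> \<psi> (t *s y)\<close> an
  integral curve of \<open>E\<close>. Hence the derivatives of \<open>f\<close> along it are the
  iterates of \<open>E\<close> on \<open>f\<close>, all zero at \<open>t = 0\<close>, and the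
  identity theorem applies on the disc of radius 2, which contains \<open>t = 1\<close>.\<close>

lemma vanish_along_segment:
  assumes f: "\<And>m t. cmod t < 2 \<Longrightarrow> cdiff ((vf_apply E ^^ m) f) (\<psi> (t *s y))"
    and psi: "\<And>t. cmod t < 2 \<Longrightarrow> vcdiff \<psi> (t *s y)"
    and E: "\<And>t. cmod t < 2 \<Longrightarrow> E (\<psi> (t *s y)) = vdd \<psi> (t *s y) y"
    and 0: "\<And>m. (vf_apply E ^^ m) f (\<psi> 0) = 0"
  shows "f (\<psi> y) = 0"
proof -
  define k where "k = (\<lambda>m t. (vf_apply E ^^ m) f (\<psi> (t *s y)))"
  have der: "(k m has_field_derivative k (Suc m) t) (at t)" if "t \<in> ball 0 2" for m t
  proof -
    have t: "cmod t < 2" using that by simp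
    have c: "cdiff (\<lambda>w. (vf_apply E ^^ m) f (\<psi> w)) (0 + t *s y)"
      using cdiff_compose[OF psi[OF t] f[OF t]] by simp
    have "dd (\<lambda>w. (vf_apply E ^^ m) f (\<psi> w)) (t *s y) y = k (Suc m) t"
      using dd_compose[OF psi[OF t] f[OF t]] E[OF t] by (simp add: k_def vf_apply_def)
    with cdiff_line[OF c] show ?thesis by (simp add: k_def)
  qed
  have "k 0 holomorphic_on ball 0 2"
    using der[of _ 0] by (meson holomorphic_onI field_differentiable_def has_field_derivative_at_within)
  moreover have "(deriv ^^ m) (k 0) 0 = 0" for m
    using higher_deriv_sequence[of "ball 0 2" k 0 m] der 0[of m] by (simp add: k_def)
  ultimately have "k 0 1 = 0"
    by (intro holomorphic_fun_eq_0_on_ball[of "k 0" 0 2]) auto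
  then show ?thesis by (simp add: k_def)
qed

text \<open>The inverse \<open>\<psi>\<close> and the image \<open>W\<close> are parameters, so both
  directions are treated alike and \<open>inv_into\<close> occurs only at the interface with
  \<open>smooth_germ\<close>.\<close>

locale chart =
  fixes U W :: "(complex^'n) set" and \<phi> \<psi> :: "complex^'n \<Rightarrow> complex^'n"
  assumes open_U: "open U" and zero_U: "0 \<in> U" and open_W: "open W"
    and \<phi>_W: "x \<in> U \<Longrightarrow> \<phi> x \<in> W" and \<psi>_U: "w \<in> W \<Longrightarrow> \<psi> w \<in> U"
    and \<psi>_\<phi>: "x \<in> U \<Longrightarrow> \<psi> (\<phi> x) = x" and \<phi>_\<psi>: "w \<in> W \<Longrightarrow> \<phi> (\<psi> w) = w"
    and \<phi>_0: "\<phi> 0 = 0"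
    and cdiff_\<phi>: "x \<in> U \<Longrightarrow> cdiff (\<lambda>y. \<phi> y $ i) x"
    and cdiff_\<psi>: "w \<in> W \<Longrightarrow> cdiff (\<lambda>y. \<psi> y $ i) w"
begin

lemma zero_W: "0 \<in> W" and \<psi>_0: "\<psi> 0 = 0"
  using \<phi>_W[OF zero_U] \<psi>_\<phi>[OF zero_U] by (simp_all add: \<phi>_0)

lemma hol_\<phi>: "x \<in> U \<Longrightarrow> hol (\<lambda>y. \<phi> y $ i) x"
  using eventually_nhds_in_open[OF open_U] cdiff_\<phi> by (blast intro: eventually_mono)

lemma hol_\<psi>: "w \<in> W \<Longrightarrow> hol (\<lambda>y. \<psi> y $ i) w"
  using eventually_nhds_in_open[OF open_W] cdiff_\<psi> by (blast intro: eventually_mono)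

lemma vdd_\<psi>_\<phi>: 
  assumes "x \<in> U" shows "vdd \<psi> (\<phi> x) (vdd \<phi> x v) = v"
proof -
  have "dd (\<lambda>z. \<psi> (\<phi> z) $ i) x = dd (\<lambda>z. z $ i) x" for i
    by (rule dd_cong, use eventually_nhds_in_open[OF open_U assms] in eventually_elim) (simp add: \<psi>_\<phi>)
  moreover have "dd (\<lambda>z. \<psi> (\<phi> z) $ i) x v = dd (\<lambda>y. \<psi> y $ i) (\<phi> x) (vdd \<phi> x v)" for i
    using dd_compose[of \<phi> x "\<lambda>y. \<psi> y $ i"] cdiff_\<phi> cdiff_\<psi> assms \<phi>_W by simp
  ultimately show ?thesis
    by (simp add: vec_eq_iff vdd_def[of \<psi>])
qed

lemma vdd_\<phi>_\<psi>: 
  assumes "w \<in> W" shows "vdd \<phi> (\<psi> w) (vdd \<psi> w v) = v"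
proof -
  have "dd (\<lambda>z. \<phi> (\<psi> z) $ i) w = dd (\<lambda>z. z $ i) w" for i
    by (rule dd_cong, use eventually_nhds_in_open[OF open_W assms] in eventually_elim) (simp add: \<phi>_\<psi>)
  moreover have "dd (\<lambda>z. \<phi> (\<psi> z) $ i) w v = dd (\<lambda>y. \<phi> y $ i) (\<psi> w) (vdd \<psi> w v)" for i
    using dd_compose[of \<psi> w "\<lambda>y. \<phi> y $ i"] cdiff_\<phi> cdiff_\<psi> assms \<psi>_U by simp
  ultimately show ?thesis
    by (simp add: vec_eq_iff vdd_def[of \<phi>])
qed

text \<open>The coordinate field in direction \<open>y\<close>: the image under
  \<open>\<psi>\<close> of the constant field \<open>y\<close>. Where defined,
  \<open>t \<mapsto> \<psi> (t *s y)\<close> is an integral curve of it.\<close>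

definition field :: "complex^'n \<Rightarrow> complex^'n \<Rightarrow> complex^'n" where
  "field y x = vdd \<psi> (\<phi> x) y"

lemma hol_field: "x \<in> U \<Longrightarrow> hol (\<lambda>x. field y x $ i) x"
proof -
  assume x: "x \<in> U"
  have "eventually (vcdiff \<phi>) (nhds x)"
    using eventually_nhds_in_open[OF open_U x] by eventually_elim (simp add: cdiff_\<phi>)
  moreover have "hol (\<lambda>w. dd (\<lambda>z. \<psi> z $ i) w y) (\<phi> x)"
    by (intro hol_dd hol_\<psi> \<phi>_W x)
  ultimately show ?thesis
    using hol_compose[of \<phi> x "\<lambda>w. dd (\<lambda>z. \<psi> z $ i) w y"] by (simp add: field_def vdd_def)
qed

lemma hol_vf_field: "hol_vf (field y)"
  by (simp add: hol_vf_iff hol_field zero_U)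

lemma open_preimage:
  assumes "open S" shows "open {w \<in> W. \<psi> w \<in> S}"
proof -
  have "continuous_on W \<psi>"
    by (intro continuous_at_imp_continuous_on ballI vcdiff_isCont) (simp add: cdiff_\<psi>)
  from continuous_open_preimage[OF this open_W assms] show ?thesis
    by (simp add: vimage_def Int_def)
qed

text \<open>Each \<open>x\<close> near the origin with \<open>\<phi> x \<in> L\<close> is reached
  from 0 along an integral curve of \<open>field (\<phi> x)\<close>, so the identity theorem on
  single complex lines suffices and no flow has to be constructed.\<close>

lemma vanish_near:
  assumes f: "hol f 0"
    and L: "\<And>c v. v \<in> L \<Longrightarrow> c *s v \<in> L"
    and it: "\<And>y m. y \<in> L \<Longrightarrow> (vf_apply (field y) ^^ m) f 0 = 0"
  shows "\<forall>\<^sub>F x in nhds 0. \<phi> x \<in> L \<longrightarrow> f x = 0"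
proof -
  obtain S where S: "open S" "0 \<in> S" "S \<subseteq> U" "\<And>x. x \<in> S \<Longrightarrow> cdiff f x"
  proof -
    obtain S where "open S" "0 \<in> S" "\<And>x. x \<in> S \<Longrightarrow> cdiff f x"
      using f by (auto simp: eventually_nhds)
    then show ?thesis
      using that[of "S \<inter> U"] open_U zero_U by auto
  qed
  have iter: "hol ((vf_apply (field y) ^^ m) f) x" if "x \<in> S" for m y x
  proof (induction m)
    case 0
    show ?case using eventually_nhds_in_open[OF S(1) that] S(4) by (auto elim: eventually_mono)
  next
    case (Suc m)
    then show ?case using hol_vf_apply[OF Suc hol_field] that S(3) by auto
  qed
  obtain r where r: "r > 0" "ball 0 r \<subseteq> {w \<in> W. \<psi> w \<in> S}"
    using open_preimage[OF S(1)] zero_W \<psi>_0 S(2) open_contains_ball by (metis (mono_tags, lifting) mem_Collect_eq)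
  \<comment> \<open>Half the radius, since the segment argument uses all \<open>t\<close> with
    \<open>cmod t < 2\<close>.\<close>
  have "f x = 0" if x: "x \<in> U" "\<phi> x \<in> L" "norm (\<phi> x) < r / 2" for x
  proof -
    have t: "t *s \<phi> x \<in> W" "\<psi> (t *s \<phi> x) \<in> S" if "cmod t < 2" for t
    proof -
      have "norm (t *s \<phi> x) \<le> 2 * norm (\<phi> x)"
        using that by (simp add: norm_smult mult_right_mono)
      then have "t *s \<phi> x \<in> ball 0 r" using x by simp
      then show "t *s \<phi> x \<in> W" "\<psi> (t *s \<phi> x) \<in> S" using r by auto
    qed
    have "f (\<psi> (\<phi> x)) = 0"
      by (rule vanish_along_segment[where E="field (\<phi> x)"])
         (use t in \<open>auto simp: cdiff_\<psi> field_def \<phi>_\<psi> \<psi>_0 it x hol_cdiff[OF iter]\<close>)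
    then show ?thesis using x by (simp add: \<psi>_\<phi>)
  qed
  moreover
  have "\<forall>\<^sub>F x in nhds 0. norm (\<phi> x) < r / 2"
  proof -
    have "isCont (\<lambda>x. norm (\<phi> x)) 0"
      using cdiff_\<phi>[OF zero_U] vcdiff_isCont by (intro continuous_intros) blast
    then have "((\<lambda>x. norm (\<phi> x)) \<longlongrightarrow> norm (\<phi> 0)) (nhds 0)"
      using tendsto_at_iff_tendsto_nhds[of "\<lambda>x. norm (\<phi> x)" 0] by (simp only: isCont_def)
    then show ?thesis using r \<phi>_0 by (intro order_tendstoD(2)) auto
  qed
  then have "\<forall>\<^sub>F x in nhds 0. x \<in> U \<and> norm (\<phi> x) < r / 2"
    using eventually_nhds_in_open[OF open_U zero_U] by eventually_elim simp
  ultimately show ?thesis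
    by (auto elim: eventually_mono)
qed

end

text \<open>Its coordinate fields are constant, so \<open>vanish_near\<close> with
  \<open>L = UNIV\<close> says that a germ is zero if all its iterated derivatives in fixed
  directions vanish at the origin.\<close>

interpretation id_chart: chart UNIV UNIV "\<lambda>x. x" "\<lambda>x. x"
  by standard auto

lemma id_chart_field: "id_chart.field y = (\<lambda>x. y)"
  by (simp add: id_chart.field_def vdd_def vec_eq_iff fun_eq_iff)

subsection \<open>Tangent algebras\<close>

lemma vanishing_ideal_iff:
  "f \<in> vanishing_ideal X \<longleftrightarrow> hol f 0 \<and> (\<forall>\<^sub>F x in nhds 0. x \<in> X \<longrightarrow> f x = 0)"
  by (simp add: vanishing_ideal_def hol_germ_iff)

lemma vanishing_ideal_cong:
  assumes "f \<in> vanishing_ideal X" "\<forall>\<^sub>F x in nhds 0. f x = g x"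
  shows "g \<in> vanishing_ideal X"
proof -
  have "\<forall>\<^sub>F x in nhds 0. x \<in> X \<longrightarrow> f x = 0" using assms(1) by (simp add: vanishing_ideal_iff)
  with assms(2) have "\<forall>\<^sub>F x in nhds 0. x \<in> X \<longrightarrow> g x = 0"
    by eventually_elim simp
  then show ?thesis
    using assms hol_cong by (auto simp: vanishing_ideal_iff)
qed

lemma vanishing_ideal_add:
  assumes "f \<in> vanishing_ideal X" "g \<in> vanishing_ideal X"
  shows "(\<lambda>x. f x + g x) \<in> vanishing_ideal X"
proof -
  have "\<forall>\<^sub>F x in nhds 0. x \<in> X \<longrightarrow> f x = 0" "\<forall>\<^sub>F x in nhds 0. x \<in> X \<longrightarrow> g x = 0"
    using assms by (simp_all add: vanishing_ideal_iff)
  then have "\<forall>\<^sub>F x in nhds 0. x \<in> X \<longrightarrow> f x + g x = 0"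
    by eventually_elim simp
  then show ?thesis using assms by (simp add: vanishing_ideal_iff hol_intros)
qed

lemma vanishing_ideal_mult:
  assumes "f \<in> vanishing_ideal X" "hol u 0"
  shows "(\<lambda>x. u x * f x) \<in> vanishing_ideal X"
proof -
  have "\<forall>\<^sub>F x in nhds 0. x \<in> X \<longrightarrow> f x = 0"
    using assms by (simp add: vanishing_ideal_iff)
  then have "\<forall>\<^sub>F x in nhds 0. x \<in> X \<longrightarrow> u x * f x = 0"
    by eventually_elim simp
  then show ?thesis using assms by (simp add: vanishing_ideal_iff hol_intros)
qed

text \<open>\<open>tangent_alg\<close> tests the chosen representative only; the vanishing ideal
  respects equality of germs, so any representative may be tested.\<close>

lemma reps_tangent_alg:
  "V \<in> reps (tangent_alg X) \<longleftrightarrow> hol_vf V \<and> (\<forall>f\<in>vanishing_ideal X. vf_apply V f \<in> vanishing_ideal X)"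
proof -
  have "vf_apply (rep (vf_germ V)) f \<in> vanishing_ideal X \<longleftrightarrow> vf_apply V f \<in> vanishing_ideal X"
    if "hol_vf V" for f
  proof -
    have "\<forall>\<^sub>F x in nhds 0. vf_apply (rep (vf_germ V)) f x = vf_apply V f x"
      by (rule vf_apply_germ_cong[OF rep_germ[OF that]]) simp
    moreover from this have "\<forall>\<^sub>F x in nhds 0. vf_apply V f x = vf_apply (rep (vf_germ V)) f x"
      by eventually_elim simp
    ultimately show ?thesis using vanishing_ideal_cong by blast
  qed
  then show ?thesis
    by (auto simp: reps_def tangent_alg_def Der_def)
qed

lemma tangent_alg_subset_Der: "tangent_alg X \<subseteq> Der"
  by (auto simp: tangent_alg_def)

lemma lie_subalg_tangent_alg: "lie_subalg (tangent_alg X)"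
proof (subst lie_subalg_iff[OF tangent_alg_subset_Der], intro conjI ballI allI)
  show "(\<lambda>x. 0) \<in> reps (tangent_alg X)"
    unfolding reps_tangent_alg
  proof (intro conjI ballI hol_vf_const)
    fix f assume f: "f \<in> vanishing_ideal X"
    then have "\<forall>\<^sub>F x in nhds 0. cdiff f x" by (simp add: vanishing_ideal_iff)
    then have "\<forall>\<^sub>F x in nhds 0. 0 * f x = vf_apply (\<lambda>x. 0) f x"
      by eventually_elim (simp add: vf_apply_def)
    then show "vf_apply (\<lambda>x. 0) f \<in> vanishing_ideal X"
      by (rule vanishing_ideal_cong[OF vanishing_ideal_mult[OF f hol_intros(1)]])
  qed
next
  fix V W assume VW: "V \<in> reps (tangent_alg X)" "W \<in> reps (tangent_alg X)"
  then have hol: "hol_vf V" "hol_vf W" by (simp_all add: reps_hol)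
  show "(\<lambda>x. V x + W x) \<in> reps (tangent_alg X)"
    unfolding reps_tangent_alg
  proof (intro conjI ballI hol_vf_add hol)
    fix f assume f: "f \<in> vanishing_ideal X"
    then have "\<forall>\<^sub>F x in nhds 0. cdiff f x" by (simp add: vanishing_ideal_iff)
    then have "\<forall>\<^sub>F x in nhds 0. vf_apply V f x + vf_apply W f x = vf_apply (\<lambda>x. V x + W x) f x"
      by eventually_elim (simp add: vf_apply_def dd_add_arg)
    then show "vf_apply (\<lambda>x. V x + W x) f \<in> vanishing_ideal X"
      by (rule vanishing_ideal_cong[rotated]) (use VW f in \<open>simp add: reps_tangent_alg vanishing_ideal_add\<close>)
  qed
  show "vf_bracket V W \<in> reps (tangent_alg X)"
    unfolding reps_tangent_alg
  proof (intro conjI ballI hol_vf_bracket hol)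
    fix f assume f: "f \<in> vanishing_ideal X"
    then have "\<forall>\<^sub>F x in nhds 0. hol f x" by (simp add: vanishing_ideal_iff eventually_eventually)
    with hol_vf_vcdiff[OF hol(1)] hol_vf_vcdiff[OF hol(2)]
    have "\<forall>\<^sub>F x in nhds 0. vf_apply V (vf_apply W f) x + (-1) * vf_apply W (vf_apply V f) x = vf_apply (vf_bracket V W) f x"
      by eventually_elim (simp add: vf_apply_bracket)
    then show "vf_apply (vf_bracket V W) f \<in> vanishing_ideal X"
      by (rule vanishing_ideal_cong[rotated])
         (intro vanishing_ideal_add vanishing_ideal_mult hol_intros; use VW f in \<open>simp add: reps_tangent_alg\<close>)
  qed
next
  fix c V assume V: "V \<in> reps (tangent_alg X)"
  show "(\<lambda>x. c *s V x) \<in> reps (tangent_alg X)"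
    unfolding reps_tangent_alg
  proof (intro conjI ballI hol_vf_smult hol_intros)
    show "hol_vf V" using V by (rule reps_hol)
    fix f assume f: "f \<in> vanishing_ideal X"
    then have "\<forall>\<^sub>F x in nhds 0. cdiff f x" by (simp add: vanishing_ideal_iff)
    then have "\<forall>\<^sub>F x in nhds 0. c * vf_apply V f x = vf_apply (\<lambda>x. c *s V x) f x"
      by eventually_elim (simp add: vf_apply_def cdiff_dd_scale)
    then show "vf_apply (\<lambda>x. c *s V x) f \<in> vanishing_ideal X"
      by (rule vanishing_ideal_cong[rotated]) (intro vanishing_ideal_mult hol_intros; use V f in \<open>simp add: reps_tangent_alg\<close>)
  qed
qed

lemma balanced_iff:
  assumes "lie_subalg A"
  shows "balanced_in A Der \<longleftrightarrow> (\<forall>I. lie_ideal_in I Der \<longrightarrow> I \<subseteq> A \<longrightarrow> I = {gzero}) \<and>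
    (\<exists>V\<in>reps A. \<not> (\<forall>\<^sub>F x in nhds 0. V x = 0) \<and> (\<forall>W. hol_vf W \<longrightarrow> vf_bracket V W \<in> reps A) \<and>
      (\<forall>W W'. hol_vf W \<longrightarrow> hol_vf W' \<longrightarrow> vf_bracket (vf_bracket V W) W' \<in> reps A))"
proof -
  have A: "A \<subseteq> Der" using assms by (simp add: lie_subalg_def)
  have bex: "(\<exists>a\<in>A. P a) \<longleftrightarrow> (\<exists>V\<in>reps A. P (vf_germ V))" for P
    using ball_germs[OF A, of "\<lambda>x. \<not> P x"] by blast
  have "(vf_germ V \<noteq> gzero \<and> (\<forall>b\<in>Der. gbr (vf_germ V) b \<in> A) \<and> (\<forall>b\<in>Der. \<forall>c\<in>Der. gbr (gbr (vf_germ V) b) c \<in> A)) \<longleftrightarrow>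
    (\<not> (\<forall>\<^sub>F x in nhds 0. V x = 0) \<and> (\<forall>W. hol_vf W \<longrightarrow> vf_bracket V W \<in> reps A) \<and>
      (\<forall>W W'. hol_vf W \<longrightarrow> hol_vf W' \<longrightarrow> vf_bracket (vf_bracket V W) W' \<in> reps A))" if "V \<in> reps A" for V
  proof -
    have V: "hol_vf V" using that by (rule reps_hol)
    have m: "vf_germ Z \<in> A \<longleftrightarrow> Z \<in> reps A" if "hol_vf Z" for Z
      using that by (simp add: reps_def)
    show ?thesis
      unfolding ball_germs[OF subset_refl] reps_Der
      by (simp add: zero_germ_iff[OF V] gbr_germ V hol_vf_bracket m)
  qed
  note ex = bex_cong[OF refl this]
  have ideals: "(\<not> (\<exists>I. lie_ideal_in I Der \<and> I \<subseteq> A \<and> I \<noteq> {gzero})) \<longleftrightarrow>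
      (\<forall>I. lie_ideal_in I Der \<longrightarrow> I \<subseteq> A \<longrightarrow> I = {gzero})"
    by blast
  show ?thesis
    unfolding balanced_in_def bex ideals using assms A by (simp add: ex cong: conj_cong)
qed


text \<open>The bracket with a constant field \<open>y\<close> is minus the derivative in direction
  \<open>y\<close>, so the ideal is closed under differentiation. If all its members vanished at the
  origin, all iterated derivatives of \<open>V\<close> would vanish there and \<open>V\<close> would
  be the zero germ.\<close>

lemma hol_vf_nonzero_reps_ideal:
  assumes I: "lie_ideal_in I Der" and V: "V \<in> reps I" "\<not> (\<forall>\<^sub>F x in nhds 0. V x = 0)"
  obtains V' where "V' \<in> reps I" "V' 0 \<noteq> 0"
proof (rule ccontr)
  note found = that
  assume neg: "\<not> thesis"
  have sub: "lie_subalg I" using I by (simp add: lie_ideal_iff)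
  have zero: "V' 0 = 0" if "V' \<in> reps I" for V' using neg found that by blast
  have iter: "(vf_apply (\<lambda>x. y) ^^ m) (\<lambda>x. V' x $ i) 0 = 0" if "V' \<in> reps I" for m y i V'
    using that
  proof (induction m arbitrary: V')
    case 0
    then show ?case by (simp add: zero)
  next
    case (Suc m)
    have "vf_bracket V' (\<lambda>x. y) \<in> reps I"
      using I Suc.prems by (simp add: lie_ideal_iff hol_vf_const)
    then have mem: "(\<lambda>x. - vf_bracket V' (\<lambda>x. y) x) \<in> reps I"
      by (rule lie_minus[OF sub])
    have "vf_apply (\<lambda>x. y) (\<lambda>x. V' x $ i) = (\<lambda>x. (- vf_bracket V' (\<lambda>x. y) x) $ i)"
      by (simp add: vf_bracket_def vf_apply_def fun_eq_iff)
    then show ?case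
      using Suc.IH[OF mem] by (simp add: funpow_swap1)
  qed
  have "\<forall>\<^sub>F x in nhds 0. V x $ i = 0" for i
    using id_chart.vanish_near[of "\<lambda>x. V x $ i" UNIV] iter[OF V(1)] reps_hol[OF V(1)]
    by (simp add: hol_vf_iff id_chart_field)
  then have "\<forall>\<^sub>F x in nhds 0. \<forall>i. V x $ i = 0"
    by (intro eventually_all_finite)
  then show False using V(2) by (simp add: vec_eq_iff)
qed

lemma ideal_value_at_0:
  assumes I: "lie_ideal_in I Der" and V: "V \<in> reps I" "\<not> (\<forall>\<^sub>F x in nhds 0. V x = 0)"
  obtains Z where "Z \<in> reps I" "Z 0 = v"
proof -
  obtain V' where V': "V' \<in> reps I" "V' 0 \<noteq> 0"
    using hol_vf_nonzero_reps_ideal[OF assms] .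
  then obtain k where k: "V' 0 $ k \<noteq> 0" by (auto simp: vec_eq_iff)
  \<comment> \<open>A linear field with \<open>W 0 = 0\<close> whose derivative sends
    \<open>V' 0\<close> to \<open>v\<close>; its bracket with \<open>V'\<close> therefore has the
    value \<open>v\<close> at 0.\<close>
  define W where "W = (\<lambda>x::complex^'a. (x $ k * inverse (V' 0 $ k)) *s v)"
  have W: "hol_vf W"
    unfolding W_def by (intro hol_vf_smult hol_intros hol_vf_const)
  have "vdd W 0 (V' 0) = v"
    using k unfolding W_def by (subst vdd_smult) (auto simp: cdiff_mult dd_mult vdd_def vec_eq_iff)
  moreover have "vdd V' 0 (W 0) = 0"
    using eventually_nhds_x_imp_x[OF hol_vf_vcdiff[OF reps_hol[OF V'(1)]]]
    by (simp add: W_def vdd_def vec_eq_iff)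
  ultimately have "vf_bracket V' W 0 = v"
    by (simp add: vf_bracket_eq)
  moreover have "vf_bracket V' W \<in> reps I"
    using I V'(1) W by (simp add: lie_ideal_iff)
  ultimately show ?thesis by (rule that[rotated])
qed

text \<open>The real orthogonal component \<open>z\<close> of \<open>v0\<close> gives the complex
  functional with coefficients \<open>cnj (z $ i)\<close>, whose real part is the inner product with
  \<open>z\<close> and so vanishes on \<open>L\<close>. Applied to \<open>\<i> *s v\<close> this
  kills the imaginary part as well.\<close>

lemma complex_functional_separating:
  fixes L :: "(complex^'n) set"
  assumes L: "subspace L" "\<And>c v. v \<in> L \<Longrightarrow> c *s v \<in> L" and "v0 \<notin> L"
  obtains a :: "complex^'n" where "\<And>v. v \<in> L \<Longrightarrow> (\<Sum>i\<in>UNIV. a $ i * v $ i) = 0" "(\<Sum>i\<in>UNIV. a $ i * v0 $ i) \<noteq> 0"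
proof -
  obtain y z where yz: "y \<in> span L" "\<And>w. w \<in> span L \<Longrightarrow> orthogonal z w" "v0 = y + z"
    using orthogonal_subspace_decomp_exists[of L v0] by metis
  have sp: "span L = L" using L(1) by (simp add: span_eq_iff)
  define a where "a = (\<chi> i. cnj (z $ i))"
  have re: "Re (\<Sum>i\<in>UNIV. a $ i * v $ i) = z \<bullet> v" for v
    by (simp add: a_def inner_vec_def inner_complex_def)
  have 0: "(\<Sum>i\<in>UNIV. a $ i * v $ i) = 0" if "v \<in> L" for v
  proof -
    have r: "Re (\<Sum>i\<in>UNIV. a $ i * w $ i) = 0" if "w \<in> L" for w
      unfolding re using yz(2) that sp by (simp add: orthogonal_def)
    have "(\<Sum>i\<in>UNIV. a $ i * (\<i> *s v) $ i) = \<i> * (\<Sum>i\<in>UNIV. a $ i * v $ i)"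
      by (simp add: sum_distrib_left mult.left_commute)
    then have "Im (\<Sum>i\<in>UNIV. a $ i * v $ i) = 0"
      using r[OF L(2)[OF that, of \<i>]] by (simp del: Re_sum)
    then show ?thesis using r[OF that] by (simp add: complex_eq_iff del: Re_sum Im_sum)
  qed
  have "z \<noteq> 0" using assms(3) yz sp by auto
  moreover have "z \<bullet> v0 = z \<bullet> z"
    using yz by (simp add: inner_add_right orthogonal_def)
  ultimately have "Re (\<Sum>i\<in>UNIV. a $ i * v0 $ i) \<noteq> 0"
    unfolding re by simp
  then have "(\<Sum>i\<in>UNIV. a $ i * v0 $ i) \<noteq> 0"
    by (metis zero_complex.sel(1))
  with 0 show ?thesis by (rule that)
qed

subsection \<open>Smooth germs\<close>

locale smooth_chart = chart U W \<phi> \<psi>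
  for U W :: "(complex^'n) set" and \<phi> \<psi> +
  fixes X L :: "(complex^'n) set"
  assumes L: "subspace L" "v \<in> L \<Longrightarrow> c *s v \<in> L"
    and X: "x \<in> U \<Longrightarrow> x \<in> X \<longleftrightarrow> \<phi> x \<in> L"
begin

lemma zero_L: "0 \<in> L"
  using L(1) by (simp add: subspace_0)

lemma not_empty: "\<not> empty_germ X"
proof
  assume "empty_germ X"
  then have "0 \<notin> X" unfolding empty_germ_def by (rule eventually_nhds_x_imp_x)
  then show False using X[OF zero_U] zero_L by (simp add: \<phi>_0)
qed

lemma full_germ_if: "L = UNIV \<Longrightarrow> full_germ X"
  using eventually_nhds_in_open[OF open_U zero_U] X unfolding full_germ_def by (auto elim: eventually_mono)

lemma smooth: "smooth_germ X"
proof -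
  have im: "\<phi> ` U = W"
    using \<phi>_W \<psi>_U \<phi>_\<psi> by (metis image_eqI image_subsetI subset_antisym subsetI)
  have inj: "inj_on \<phi> U" using \<psi>_\<phi> by (metis inj_onI)
  have inv: "inv_into U \<phi> w = \<psi> w" if "w \<in> W" for w
    using inj \<psi>_U[OF that] \<phi>_\<psi>[OF that] by (metis inv_into_f_eq)
  have "cdiff (\<lambda>w. inv_into U \<phi> w $ i) w" if "w \<in> W" for w i
    using cdiff_\<psi>[OF that] by (subst cdiff_cong[where g="\<lambda>w. \<psi> w $ i"])
      (use eventually_nhds_in_open[OF open_W that] in \<open>auto simp: inv elim: eventually_mono\<close>)
  moreover have "\<phi> ` (X \<inter> U) = L \<inter> \<phi> ` U"
    using X by auto
  ultimately show ?thesis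
    unfolding smooth_germ_def holo_vec_on_def holo_on_iff
    using open_U zero_U open_W inj \<phi>_0 L cdiff_\<phi> im
    by (intro disjI2 exI[of _ U] exI[of _ \<phi>] exI[of _ L]) auto
qed

text \<open>The line through \<open>\<phi> x\<close> in a direction from \<open>L\<close> stays in
  \<open>L\<close>, so \<open>f \<circ> \<psi>\<close> is zero along it near \<open>t = 0\<close>.
  The neighbourhood of the origin is the same for all directions, which allows \<open>v\<close> to
  be the varying value \<open>V x\<close> of a field.\<close>

lemma vanish_on_L_derivative:
  assumes f: "hol f 0" and van: "\<forall>\<^sub>F x in nhds 0. x \<in> X \<longrightarrow> f x = 0"
  shows "\<forall>\<^sub>F x in nhds 0. \<forall>v. x \<in> X \<longrightarrow> vdd \<phi> x v \<in> L \<longrightarrow> dd f x v = 0"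
proof -
  have "\<forall>\<^sub>F x in nhds 0. cdiff f x \<and> (x \<in> X \<longrightarrow> f x = 0)"
    using f van by eventually_elim simp
  then obtain S where S: "open S" "0 \<in> S" "\<And>x. x \<in> S \<Longrightarrow> cdiff f x" "\<And>x. x \<in> S \<Longrightarrow> x \<in> X \<Longrightarrow> f x = 0"
    by (auto simp: eventually_nhds)
  have "dd f x v = 0" if x: "x \<in> S" "x \<in> U" "x \<in> X" and v: "vdd \<phi> x v \<in> L" for x v
  proof -
    let ?w = "\<phi> x" and ?l = "vdd \<phi> x v"
    let ?k = "\<lambda>t. f (\<psi> (?w + t *s ?l))"
    have w: "?w \<in> W" "?w \<in> L" "\<psi> ?w = x" using x by (auto simp: \<phi>_W X \<psi>_\<phi>)
    have cf: "cdiff f (\<psi> ?w)" using S(3) x by (simp add: w)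
    have c: "cdiff (\<lambda>w. f (\<psi> w)) ?w"
      using cdiff_compose[of \<psi> ?w f] cf cdiff_\<psi> w by blast
    have 1: "(?k has_field_derivative dd (\<lambda>w. f (\<psi> w)) ?w ?l) (at 0)"
      using cdiff_line[of "\<lambda>w. f (\<psi> w)" ?w 0 ?l] c by simp
    have cont: "isCont (\<lambda>t. ?w + t *s ?l) 0"
      by (intro continuous_intros bounded_linear.isCont[OF bounded_linear_smult_left])
    have "\<forall>\<^sub>F t in nhds 0. ?w + t *s ?l \<in> {w \<in> W. \<psi> w \<in> S}"
    proof -
      have "((\<lambda>t. ?w + t *s ?l) \<longlongrightarrow> ?w) (nhds 0)"
        using cont tendsto_at_iff_tendsto_nhds[of "\<lambda>t. ?w + t *s ?l" 0] by (simp add: isCont_def)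
      then show ?thesis
        using topological_tendstoD[OF _ open_preimage[OF S(1)], of "\<lambda>t. ?w + t *s ?l" ?w "nhds 0"] w x by simp
    qed
    then have "\<forall>\<^sub>F t in nhds 0. ?k t = 0"
    proof eventually_elim
      case (elim t)
      have "?w + t *s ?l \<in> L" using w v L by (simp add: subspace_add)
      then have "\<psi> (?w + t *s ?l) \<in> X" using elim X \<psi>_U \<phi>_\<psi> by auto
      then show ?case using elim S(4) by auto
    qed
    then have "(?k has_field_derivative dd (\<lambda>w. f (\<psi> w)) ?w ?l) (at 0) \<longleftrightarrow> ((\<lambda>t. 0) has_field_derivative dd (\<lambda>w. f (\<psi> w)) ?w ?l) (at 0)"
      by (intro DERIV_cong_ev) auto
    with 1 have "dd (\<lambda>w. f (\<psi> w)) ?w ?l = 0"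
      using DERIV_unique[OF _ DERIV_const[of 0 "at 0"]] by blast
    then show ?thesis
      using dd_compose[of \<psi> ?w f ?l] cf cdiff_\<psi> w vdd_\<psi>_\<phi>[OF x(2)] by simp
  qed
  moreover have "\<forall>\<^sub>F x in nhds 0. x \<in> S \<and> x \<in> U"
    using S open_U zero_U by (auto simp: eventually_conj_iff intro: eventually_nhds_in_open)
  ultimately show ?thesis by (auto elim: eventually_mono)
qed

lemma tangentI:
  assumes V: "hol_vf V" and t: "\<forall>\<^sub>F x in nhds 0. x \<in> X \<longrightarrow> vdd \<phi> x (V x) \<in> L"
  shows "V \<in> reps (tangent_alg X)"
  unfolding reps_tangent_alg
proof (intro conjI ballI V)
  fix f assume "f \<in> vanishing_ideal X"
  then have f: "hol f 0" "\<forall>\<^sub>F x in nhds 0. x \<in> X \<longrightarrow> f x = 0" by (simp_all add: vanishing_ideal_iff)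
  from vanish_on_L_derivative[OF f] t have "\<forall>\<^sub>F x in nhds 0. x \<in> X \<longrightarrow> vf_apply V f x = 0"
    by eventually_elim (simp add: vf_apply_def)
  then show "vf_apply V f \<in> vanishing_ideal X"
    using f V by (simp add: vanishing_ideal_iff hol_vf_apply_germ)
qed

lemma tangentI_zero:
  assumes V: "hol_vf V" and t: "\<forall>\<^sub>F x in nhds 0. x \<in> X \<longrightarrow> V x = 0"
  shows "V \<in> reps (tangent_alg X)"
proof (rule tangentI[OF V])
  have "\<forall>\<^sub>F x in nhds 0. x \<in> U"
    using open_U zero_U by (intro eventually_nhds_in_open)
  with t show "\<forall>\<^sub>F x in nhds 0. x \<in> X \<longrightarrow> vdd \<phi> x (V x) \<in> L"
    by eventually_elim (simp add: vdd_def cdiff_\<phi> flip: zero_vec_def, simp add: zero_L)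
qed

lemma field_tangent: "y \<in> L \<Longrightarrow> field y \<in> reps (tangent_alg X)"
proof (rule tangentI[OF hol_vf_field])
  assume "y \<in> L"
  then show "\<forall>\<^sub>F x in nhds 0. x \<in> X \<longrightarrow> vdd \<phi> x (field y x) \<in> L"
    using eventually_nhds_in_open[OF open_U zero_U]
    by (auto elim!: eventually_mono simp: field_def) (metis \<phi>_W \<psi>_\<phi> vdd_\<phi>_\<psi>)
qed

text \<open>A complex linear functional that vanishes on \<open>L\<close> but not at
  \<open>v0\<close>, composed with the chart; in coordinates its derivative at 0 is the functional
  itself.\<close>

lemma defining_function:
  assumes "v0 \<notin> L"
  obtains f where "f \<in> vanishing_ideal X" "dd f 0 (field v0 0) \<noteq> 0"
    "\<And>v. v \<in> L \<Longrightarrow> dd f 0 (field v 0) = 0"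
proof -
  obtain a where a: "\<And>v. v \<in> L \<Longrightarrow> (\<Sum>i\<in>UNIV. a $ i * v $ i) = 0" "(\<Sum>i\<in>UNIV. a $ i * v0 $ i) \<noteq> 0"
    using complex_functional_separating[OF L assms] by blast
  define f where "f = (\<lambda>x. \<Sum>i\<in>UNIV. a $ i * \<phi> x $ i)"
  have "hol f 0"
    unfolding f_def by (intro hol_sum hol_intros hol_\<phi> zero_U)
  moreover have "\<forall>\<^sub>F x in nhds 0. x \<in> X \<longrightarrow> f x = 0"
    using eventually_nhds_in_open[OF open_U zero_U]
    by eventually_elim (simp add: f_def X a)
  moreover have "dd f 0 v = (\<Sum>i\<in>UNIV. a $ i * vdd \<phi> 0 v $ i)" for v
    unfolding f_def by (simp add: dd_sum cdiff_mult cdiff_\<phi> zero_U dd_mult vdd_def)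
  moreover have "vdd \<phi> 0 (field v 0) = v" for v
    using vdd_\<phi>_\<psi>[OF zero_W, of v] by (simp add: field_def \<phi>_0 \<psi>_0)
  ultimately show ?thesis
    using that[of f] a by (simp add: vanishing_ideal_iff)
qed

text \<open>A defining function has nonzero derivative at 0, while on a full germ it would be the
  zero germ.\<close>

lemma not_full:
  assumes "L \<noteq> UNIV" shows "\<not> full_germ X"
proof
  assume "full_germ X"
  then have full: "\<forall>\<^sub>F x in nhds 0. x \<in> X" by (simp add: full_germ_def)
  obtain v0 where "v0 \<notin> L" using assms by auto
  then obtain f where f: "f \<in> vanishing_ideal X" "dd f 0 (field v0 0) \<noteq> 0"
    using defining_function by blast
  have "\<forall>\<^sub>F x in nhds 0. x \<in> X \<longrightarrow> f x = 0" using f(1) by (simp add: vanishing_ideal_iff)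
  with full have "\<forall>\<^sub>F x in nhds 0. f x = 0" by eventually_elim simp
  then have "dd f 0 = dd (\<lambda>x. 0) 0" by (rule dd_cong)
  then show False using f(2) by simp
qed

text \<open>The Leibniz rule gives
  \<open>[f^(k+1) Z, C] = f^k (f [Z, C] - (k+1) C(f) Z)\<close>.\<close>

lemma hol_vf_power_bracket:
  assumes "hol f 0" "hol_vf Z" "hol_vf C"
  obtains Z' where "hol_vf Z'" "\<forall>\<^sub>F x in nhds 0. vf_bracket (\<lambda>x. f x ^ Suc k *s Z x) C x = f x ^ k *s Z' x"
proof -
  define Z' where "Z' = (\<lambda>x. f x *s vf_bracket Z C x - (of_nat (Suc k) * vf_apply C f x) *s Z x)"
  have "hol_vf Z'"
    unfolding Z'_def using assms by (intro hol_vf_diff hol_vf_smult hol_vf_bracket hol_intros hol_vf_apply_germ)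
  moreover have "\<forall>\<^sub>F x in nhds 0. vf_bracket (\<lambda>x. f x ^ Suc k *s Z x) C x = f x ^ k *s Z' x"
    using assms(1) hol_vf_vcdiff[OF assms(2)] hol_vf_vcdiff[OF assms(3)]
  proof eventually_elim
    case (elim x)
    have p: "cdiff (\<lambda>x. f x ^ k) x \<and> dd (\<lambda>x. f x ^ Suc k) x v = of_nat (Suc k) * f x ^ k * dd f x v" for k v
    proof (induction k)
      case (Suc k)
      then have "cdiff (\<lambda>x. f x ^ Suc k) x" using elim by (simp add: cdiff_mult)
      moreover have "dd (\<lambda>x. f x ^ Suc (Suc k)) x v = f x * dd (\<lambda>x. f x ^ Suc k) x v + dd f x v * f x ^ Suc k"
        using dd_mult[of f x "\<lambda>x. f x ^ Suc k" v] elim calculation by simp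
      ultimately show ?case using Suc by (simp add: algebra_simps)
    qed simp
    have "vf_bracket (\<lambda>x. f x ^ Suc k *s Z x) C x = f x ^ Suc k *s vf_bracket Z C x - vf_apply C (\<lambda>x. f x ^ Suc k) x *s Z x"
      using p[of "Suc k"] elim by (intro vf_bracket_smult_left) auto
    also have "vf_apply C (\<lambda>x. f x ^ Suc k) x = of_nat (Suc k) * f x ^ k * vf_apply C f x"
      using p[of k] by (simp add: vf_apply_def)
    finally show ?case
      by (simp add: Z'_def vec_eq_iff algebra_simps)
  qed
  ultimately show ?thesis by (rule that)
qed

lemma balanced:
  assumes "L \<noteq> UNIV"
  shows "balanced_in (tangent_alg X) Der"
  unfolding balanced_iff[OF lie_subalg_tangent_alg]
proof (intro conjI allI impI)
  obtain v0 where v0: "v0 \<notin> L" using assms by auto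
  obtain f where f: "f \<in> vanishing_ideal X" "dd f 0 (field v0 0) \<noteq> 0"
    using defining_function[OF v0] by blast
  have hf: "hol f 0" "\<forall>\<^sub>F x in nhds 0. x \<in> X \<longrightarrow> f x = 0" using f(1) by (simp_all add: vanishing_ideal_iff)
  show "I = {gzero}" if I: "lie_ideal_in I Der" and sub: "I \<subseteq> tangent_alg X" for I
  proof (rule ccontr)
    assume "I \<noteq> {gzero}"
    moreover have "gzero \<in> I" "I \<subseteq> Der" using I by (simp_all add: lie_ideal_in_def lie_subalg_def)
    ultimately obtain G where "G \<in> I" "G \<noteq> gzero" by blast
    then obtain V where V: "V \<in> reps I" "vf_germ V \<noteq> gzero"
      using germs_eq_reps[OF \<open>I \<subseteq> Der\<close>] by (metis imageE)
    then have "\<not> (\<forall>\<^sub>F x in nhds 0. V x = 0)" by (simp add: zero_germ_iff reps_hol)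
    \<comment> \<open>The ideal contains a field whose value at 0 is not tangent to
      \<open>X\<close>; it maps the defining function \<open>f\<close> to a germ that is nonzero at
      \<open>0 \<in> X\<close>.\<close>
    from ideal_value_at_0[OF I V(1) this, of "field v0 0"]
    obtain Z where Z: "Z \<in> reps I" "Z 0 = field v0 0" by blast
    have "Z \<in> reps (tangent_alg X)"
      using sub Z(1) by (auto simp: reps_def)
    then have "vf_apply Z f \<in> vanishing_ideal X" using f(1) by (simp add: reps_tangent_alg)
    then have "\<forall>\<^sub>F x in nhds 0. x \<in> X \<longrightarrow> vf_apply Z f x = 0" by (simp add: vanishing_ideal_iff)
    then have "0 \<in> X \<longrightarrow> vf_apply Z f 0 = 0" by (rule eventually_nhds_x_imp_x)
    then show False using f(2) Z(2) X[OF zero_U] zero_L by (simp add: vf_apply_def \<phi>_0)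
  qed
  define e where "e = (axis undefined 1 :: complex^'n)"
  \<comment> \<open>Each bracket with \<open>?a\<close> costs one power of \<open>f\<close>, so a multiple of \<open>f\<close> survives two brackets.\<close>
  let ?a = "\<lambda>x. f x ^ Suc (Suc 1) *s e"
  have mem: "(\<lambda>x. f x *s Z x) \<in> reps (tangent_alg X)" if Z: "hol_vf Z" for Z
  proof (rule tangentI_zero)
    show "hol_vf (\<lambda>x. f x *s Z x)" using hf Z by (intro hol_vf_smult)
    show "\<forall>\<^sub>F x in nhds 0. x \<in> X \<longrightarrow> f x *s Z x = 0" using hf(2) by eventually_elim simp
  qed
  show "\<exists>V\<in>reps (tangent_alg X). \<not> (\<forall>\<^sub>F x in nhds 0. V x = 0) \<and> (\<forall>W. hol_vf W \<longrightarrow> vf_bracket V W \<in> reps (tangent_alg X)) \<and>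
      (\<forall>W W'. hol_vf W \<longrightarrow> hol_vf W' \<longrightarrow> vf_bracket (vf_bracket V W) W' \<in> reps (tangent_alg X))"
  proof (intro bexI[of _ ?a] conjI allI impI)
    have "hol_vf (\<lambda>x. f x ^ Suc 1 *s e)"
      by (intro hol_vf_smult hol_power hol_vf_const hf)
    from mem[OF this] show "?a \<in> reps (tangent_alg X)"
      by simp
    show "\<not> (\<forall>\<^sub>F x in nhds 0. ?a x = 0)"
    proof
      assume "\<forall>\<^sub>F x in nhds 0. ?a x = 0"
      then have "\<forall>\<^sub>F x in nhds 0. f x = 0"
        by eventually_elim (auto simp: e_def vec_eq_iff axis_def split: if_splits)
      then have "dd f 0 = dd (\<lambda>x. 0) 0" by (rule dd_cong)
      then show False using f(2) by simp
    qed
    fix W :: "complex^'n \<Rightarrow> complex^'n" assume W: "hol_vf W"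
    obtain Z where Z: "hol_vf Z" "\<forall>\<^sub>F x in nhds 0. vf_bracket ?a W x = f x ^ Suc 1 *s Z x"
      using hol_vf_power_bracket[OF hf(1) hol_vf_const W] by blast
    have "(\<lambda>x. f x *s (f x *s Z x)) \<in> reps (tangent_alg X)"
      using hf Z by (intro mem hol_vf_smult)
    moreover have "\<forall>\<^sub>F x in nhds 0. f x *s (f x *s Z x) = vf_bracket ?a W x"
      using Z(2) by eventually_elim simp
    ultimately show "vf_bracket ?a W \<in> reps (tangent_alg X)" by (rule reps_cong)
    fix W' :: "complex^'n \<Rightarrow> complex^'n" assume W': "hol_vf W'"
    obtain Z' where Z': "hol_vf Z'" "\<forall>\<^sub>F x in nhds 0. vf_bracket (\<lambda>x. f x ^ Suc 1 *s Z x) W' x = f x ^ 1 *s Z' x"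
      using hol_vf_power_bracket[OF hf(1) Z(1) W'] by blast
    have "\<forall>\<^sub>F x in nhds 0. vf_bracket (vf_bracket ?a W) W' x = vf_bracket (\<lambda>x. f x ^ Suc 1 *s Z x) W' x"
      by (rule vf_bracket_cong[OF Z(2)]) simp
    with Z'(2) have "\<forall>\<^sub>F x in nhds 0. f x *s Z' x = vf_bracket (vf_bracket ?a W) W' x"
      by eventually_elim simp
    then show "vf_bracket (vf_bracket ?a W) W' \<in> reps (tangent_alg X)"
      by (rule reps_cong[OF mem[OF Z'(1)]])
  qed
qed

end

lemma smooth_germ_chart:
  fixes X :: "(complex^'n) set"
  assumes "smooth_germ X" "\<not> empty_germ X"
  obtains U W \<phi> \<psi> L where "smooth_chart U W \<phi> \<psi> X L"
proof -
  obtain U and \<phi> :: "complex^'n \<Rightarrow> complex^'n" and L where *: "open U" "0 \<in> U" "holo_vec_on \<phi> U" "inj_on \<phi> U"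
        "open (\<phi> ` U)" "holo_vec_on (inv_into U \<phi>) (\<phi> ` U)" "\<phi> 0 = 0"
        "subspace L" "\<forall>c. \<forall>v\<in>L. c *s v \<in> L" "\<phi> ` (X \<inter> U) = L \<inter> \<phi> ` U"
    using assms unfolding smooth_germ_def by blast
  have "smooth_chart U (\<phi> ` U) \<phi> (inv_into U \<phi>) X L"
  proof
    show "x \<in> X \<longleftrightarrow> \<phi> x \<in> L" if "x \<in> U" for x
    proof -
      have "\<phi> x \<in> \<phi> ` (X \<inter> U) \<longleftrightarrow> x \<in> X"
        using that *(4) by (auto dest: inj_onD)
      then show ?thesis using *(10) that by auto
    qed
  qed (use * in \<open>auto simp: holo_vec_on_def holo_on_iff inv_into_into f_inv_into_f\<close>)
  then show ?thesis by (rule that)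
qed

text \<open>The two vanishing ideals agree. For \<open>g\<close> in the ideal of \<open>X\<close>,
  the field \<open>g e\<close> lies in the smaller algebra; applied to a defining function of
  \<open>Y\<close> it gives \<open>g\<close> times a unit, so \<open>g\<close> vanishes on
  \<open>Y\<close>. Conversely the coordinate fields along \<open>L\<close> are tangent to
  \<open>X\<close> and hence preserve the ideal of \<open>Y\<close>; so for \<open>g\<close> in that
  ideal all iterates vanish at \<open>0 \<in> Y\<close>, and by \<open>vanish_near\<close>
  \<open>g\<close> vanishes on \<open>X\<close>.\<close>

lemma tangent_alg_subset_imp_eq:
  assumes "smooth_chart U W \<phi> \<psi> X L" "smooth_chart U' W' \<phi>' \<psi>' Y M" "M \<noteq> UNIV"
    and sub: "tangent_alg X \<subseteq> tangent_alg Y"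
  shows "tangent_alg X = tangent_alg Y"
proof -
  interpret X: smooth_chart U W \<phi> \<psi> X L by fact
  interpret Y: smooth_chart U' W' \<phi>' \<psi>' Y M by fact
  have reps_sub: "V \<in> reps (tangent_alg Y)" if "V \<in> reps (tangent_alg X)" for V
    using sub that by (auto simp: reps_def)
  obtain v0 where "v0 \<notin> M" using assms(3) by auto
  then obtain f where f: "f \<in> vanishing_ideal Y" "dd f 0 (Y.field v0 0) \<noteq> 0"
    using Y.defining_function by blast
  define e where "e = Y.field v0 0"
  have hf: "hol f 0" using f(1) by (simp add: vanishing_ideal_iff)
  have "g \<in> vanishing_ideal Y" if g: "g \<in> vanishing_ideal X" for g
  proof -
    have hg: "hol g 0" "\<forall>\<^sub>F x in nhds 0. x \<in> X \<longrightarrow> g x = 0" using g by (simp_all add: vanishing_ideal_iff)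
    have "(\<lambda>x. g x *s e) \<in> reps (tangent_alg X)"
    proof (rule X.tangentI_zero)
      show "hol_vf (\<lambda>x. g x *s e)" using hg by (intro hol_vf_smult hol_vf_const)
      show "\<forall>\<^sub>F x in nhds 0. x \<in> X \<longrightarrow> g x *s e = 0" using hg(2) by eventually_elim simp
    qed
    from reps_sub[OF this] have "vf_apply (\<lambda>x. g x *s e) f \<in> vanishing_ideal Y"
      using f(1) by (simp add: reps_tangent_alg)
    then have "\<forall>\<^sub>F x in nhds 0. x \<in> Y \<longrightarrow> vf_apply (\<lambda>x. g x *s e) f x = 0"
      by (simp add: vanishing_ideal_iff)
    moreover have "\<forall>\<^sub>F x in nhds 0. dd f x e \<noteq> 0"
      using eventually_nonzero[OF hol_cdiff[OF hol_dd[OF hf]]] f(2) by (simp add: e_def)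
    ultimately have "\<forall>\<^sub>F x in nhds 0. x \<in> Y \<longrightarrow> g x = 0"
      using hf by eventually_elim (simp add: vf_apply_def cdiff_dd_scale)
    then show ?thesis using hg by (simp add: vanishing_ideal_iff)
  qed
  moreover have "g \<in> vanishing_ideal X" if g: "g \<in> vanishing_ideal Y" for g
  proof -
    have hg: "hol g 0" using g by (simp add: vanishing_ideal_iff)
    have "(vf_apply (X.field y) ^^ m) g \<in> vanishing_ideal Y" if "y \<in> L" for y m
      using g reps_sub[OF X.field_tangent[OF that]] by (induction m) (simp_all add: reps_tangent_alg)
    then have "\<forall>\<^sub>F x in nhds 0. x \<in> Y \<longrightarrow> (vf_apply (X.field y) ^^ m) g x = 0" if "y \<in> L" for y m
      using that by (simp add: vanishing_ideal_iff)
    then have "0 \<in> Y \<longrightarrow> (vf_apply (X.field y) ^^ m) g 0 = 0" if "y \<in> L" for y m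
      using that eventually_nhds_x_imp_x by blast
    then have "(vf_apply (X.field y) ^^ m) g 0 = 0" if "y \<in> L" for y m
      using that Y.X[OF Y.zero_U] Y.zero_L by (simp add: Y.\<phi>_0)
    from X.vanish_near[OF hg X.L(2) this] have "\<forall>\<^sub>F x in nhds 0. \<phi> x \<in> L \<longrightarrow> g x = 0" by blast
    with eventually_nhds_in_open[OF X.open_U X.zero_U] have "\<forall>\<^sub>F x in nhds 0. x \<in> X \<longrightarrow> g x = 0"
      by eventually_elim (simp add: X.X)
    then show ?thesis using hg by (simp add: vanishing_ideal_iff)
  qed
  ultimately have "vanishing_ideal X = vanishing_ideal Y" by blast
  then show ?thesis by (simp add: tangent_alg_def)
qed


subsection \<open>Balanced subalgebras\<close>

text \<open>The key identity: a combination of double brackets with \<open>a\<close> in which all derivatives cancel.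
  Since \<open>c \<mapsto> c + c\<^sub>i e\<close> is onto, it puts all multiples of the component \<open>a\<^sub>i\<close> into \<open>A\<close>.\<close>

lemma sq_bracket:
  assumes a: "\<And>k. hol (\<lambda>y. a y $ k) x" and c: "\<And>k. hol (\<lambda>y. c y $ k) x"
    and e: "e = axis i 1"
  shows "- vf_bracket (vf_bracket a (\<lambda>y. (y $ i * y $ i) *s e)) c x
    + 2 *s vf_bracket (vf_bracket a (\<lambda>y. y $ i *s e)) (\<lambda>y. y $ i *s c y) x
    - vf_bracket (vf_bracket a (\<lambda>y. e)) (\<lambda>y. (y $ i * y $ i) *s c y) x
    = (2 * a x $ i) *s (c x + c x $ i *s e)"
proof -
  \<comment> \<open>By the Leibniz rule the three inner brackets are combinations of
    \<open>e\<close> and \<open>B\<close> (\<open>s1\<close>, \<open>s2\<close>), so after the outer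
    bracket only \<open>[e, c]\<close>, \<open>[B, c]\<close>, \<open>B\<close>, \<open>c\<close>
    and \<open>e\<close> occur.\<close>
  define B where "B = vf_bracket a (\<lambda>y. e)"
  have ae: "\<forall>\<^sub>F y in nhds x. vcdiff a y"
    using a by (intro eventually_all_finite)
  have hB: "hol (\<lambda>y. B y $ k) x" for k
    using a by (auto simp: B_def vf_bracket_def intro!: hol_intros hol_vf_apply)
  have va: "cdiff (\<lambda>y. a y $ k) x" and vc: "cdiff (\<lambda>y. c y $ k) x" and vB: "cdiff (\<lambda>y. B y $ k) x" for k
    using a c hB by (auto intro: hol_cdiff)
  have s1: "\<forall>\<^sub>F y in nhds x. vf_bracket a (\<lambda>y. y $ i *s e) y = a y $ i *s e + y $ i *s B y"
    using ae by eventually_elim (subst vf_bracket_smult_right, auto simp: B_def vf_apply_def)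
  have s2: "\<forall>\<^sub>F y in nhds x. vf_bracket a (\<lambda>y. (y $ i * y $ i) *s e) y = (2 * y $ i * a y $ i) *s e + (y $ i * y $ i) *s B y"
    using ae by eventually_elim (subst vf_bracket_smult_right, auto simp: B_def vf_apply_def cdiff_mult dd_mult)
  have ve: "vcdiff (\<lambda>y. e) x" by simp
  note simps = va vc vB cdiff_mult dd_mult vf_apply_def vf_bracket_add_left vf_bracket_smult_left vf_bracket_smult_right
  have b1: "vf_bracket (vf_bracket a (\<lambda>y. (y $ i * y $ i) *s e)) c x =
    (2 * x $ i * a x $ i) *s vf_bracket (\<lambda>y. e) c x - (2 * c x $ i * a x $ i + 2 * x $ i * vf_apply c (\<lambda>y. a y $ i) x) *s e
    + ((x $ i * x $ i) *s vf_bracket B c x - (2 * x $ i * c x $ i) *s B x)"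
  proof -
    have "vf_bracket (vf_bracket a (\<lambda>y. (y $ i * y $ i) *s e)) c x =
      vf_bracket (\<lambda>y. (2 * y $ i * a y $ i) *s e + (y $ i * y $ i) *s B y) c x"
      using eventually_nhds_x_imp_x[OF vf_bracket_cong[OF s2]] by simp
    also have "\<dots> = vf_bracket (\<lambda>y. (2 * y $ i * a y $ i) *s e) c x + vf_bracket (\<lambda>y. (y $ i * y $ i) *s B y) c x"
      by (rule vf_bracket_add_left) (simp_all add: simps)
    also have "vf_bracket (\<lambda>y. (2 * y $ i * a y $ i) *s e) c x =
        (2 * x $ i * a x $ i) *s vf_bracket (\<lambda>y. e) c x - (2 * c x $ i * a x $ i + 2 * x $ i * vf_apply c (\<lambda>y. a y $ i) x) *s e"
      by (subst vf_bracket_smult_left) (simp_all add: simps algebra_simps)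
    also have "vf_bracket (\<lambda>y. (y $ i * y $ i) *s B y) c x = (x $ i * x $ i) *s vf_bracket B c x - (2 * x $ i * c x $ i) *s B x"
      by (subst vf_bracket_smult_left) (simp_all add: simps algebra_simps)
    finally show ?thesis .
  qed
  have b2: "vf_bracket (vf_bracket a (\<lambda>y. y $ i *s e)) (\<lambda>y. y $ i *s c y) x =
    (a x $ i + x $ i * B x $ i) *s c x
    + x $ i *s (a x $ i *s vf_bracket (\<lambda>y. e) c x - vf_apply c (\<lambda>y. a y $ i) x *s e + (x $ i *s vf_bracket B c x - c x $ i *s B x))"
  proof -
    have "vf_bracket (vf_bracket a (\<lambda>y. y $ i *s e)) (\<lambda>y. y $ i *s c y) x =
      vf_bracket (\<lambda>y. a y $ i *s e + y $ i *s B y) (\<lambda>y. y $ i *s c y) x"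
      using eventually_nhds_x_imp_x[OF vf_bracket_cong[OF s1]] by simp
    also have "\<dots> = vf_apply (\<lambda>y. a y $ i *s e + y $ i *s B y) (\<lambda>y. y $ i) x *s c x
       + x $ i *s vf_bracket (\<lambda>y. a y $ i *s e + y $ i *s B y) c x"
      by (subst vf_bracket_smult_right) (simp_all add: va vc vB cdiff_mult cdiff_add)
    also have "vf_apply (\<lambda>y. a y $ i *s e + y $ i *s B y) (\<lambda>y. y $ i) x = a x $ i + x $ i * B x $ i"
      by (simp add: vf_apply_def e)
    also have "vf_bracket (\<lambda>y. a y $ i *s e + y $ i *s B y) c x = vf_bracket (\<lambda>y. a y $ i *s e) c x + vf_bracket (\<lambda>y. y $ i *s B y) c x"
      by (rule vf_bracket_add_left) (simp_all add: simps)
    also have "vf_bracket (\<lambda>y. a y $ i *s e) c x = a x $ i *s vf_bracket (\<lambda>y. e) c x - vf_apply c (\<lambda>y. a y $ i) x *s e"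
      by (subst vf_bracket_smult_left) (simp_all add: simps)
    also have "vf_bracket (\<lambda>y. y $ i *s B y) c x = x $ i *s vf_bracket B c x - c x $ i *s B x"
      by (subst vf_bracket_smult_left) (simp_all add: simps)
    finally show ?thesis .
  qed
  have b3: "vf_bracket (vf_bracket a (\<lambda>y. e)) (\<lambda>y. (y $ i * y $ i) *s c y) x =
     (2 * x $ i * B x $ i) *s c x + (x $ i * x $ i) *s vf_bracket B c x"
    unfolding B_def[symmetric] by (subst vf_bracket_smult_right) (simp_all add: simps algebra_simps)
  \<comment> \<open>With weights -1, 2, -1 the coefficients of \<open>[e, c]\<close>,
    \<open>[B, c]\<close> and \<open>B\<close> sum to zero, as do the terms \<open>c(a_i) e\<close>
    and \<open>x_i B_i c\<close>; what remains is \<open>2 a_i c\<close> and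
    \<open>2 a_i c_i e\<close>.\<close>
  show ?thesis
    unfolding b1 b2 b3 by (simp add: vec_eq_iff algebra_simps)
qed

lemma component_mult_in_balanced:
  assumes A: "lie_subalg A" and V: "hol_vf V"
    and br2: "\<And>W W'. hol_vf W \<Longrightarrow> hol_vf W' \<Longrightarrow> vf_bracket (vf_bracket V W) W' \<in> reps A"
    and C: "hol_vf C"
  shows "(\<lambda>x. V x $ i *s C x) \<in> reps A"
proof -
  define e where "e = (axis i 1 :: complex^'a)"
  define c where "c = (\<lambda>x. C x - (C x $ i / 2) *s e)" \<comment> \<open>solves \<open>c + c\<^sub>i e = C\<close>\<close>
  have hC: "hol (\<lambda>x. C x $ k) 0" for k using C by (simp add: hol_vf_iff)
  have c: "hol_vf c"
    unfolding c_def using C hC hol_intros(5)[OF hol_intros(1)[of "1/2"] hC]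
    by (intro hol_vf_diff hol_vf_smult hol_vf_const) simp_all
  have cc: "c x + c x $ i *s e = C x" for x
    by (simp add: c_def e_def vec_eq_iff axis_def)
  define T1 where "T1 = vf_bracket (vf_bracket V (\<lambda>y. (y $ i * y $ i) *s e)) c"
  define T2 where "T2 = vf_bracket (vf_bracket V (\<lambda>y. y $ i *s e)) (\<lambda>y. y $ i *s c y)"
  define T3 where "T3 = vf_bracket (vf_bracket V (\<lambda>y. e)) (\<lambda>y. (y $ i * y $ i) *s c y)"
  have T: "T1 \<in> reps A" "T2 \<in> reps A" "T3 \<in> reps A"
    unfolding T1_def T2_def T3_def
    by (intro br2 hol_vf_smult hol_vf_const hol_intros c)+
  have "(\<lambda>x. (1/2) *s (((-1) *s T1 x + 2 *s T2 x) + (-1) *s T3 x)) \<in> reps A"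
    by (intro lie_scale[OF A] lie_add[OF A] T)
  moreover have "\<forall>\<^sub>F x in nhds 0. (1/2) *s (((-1) *s T1 x + 2 *s T2 x) + (-1) *s T3 x) = V x $ i *s C x"
    using hol_vf_hol[OF V] hol_vf_hol[OF c]
  proof eventually_elim
    case (elim x)
    then have "- T1 x + 2 *s T2 x - T3 x = (2 * V x $ i) *s C x"
      unfolding T1_def T2_def T3_def using sq_bracket[of V x c e i] by (simp add: e_def[symmetric] cc)
    moreover have "V x $ i *s C x = (1/2) *s ((2 * V x $ i) *s C x)"
      by (simp add: vec_eq_iff)
    ultimately have "V x $ i *s C x = (1/2) *s (- T1 x + 2 *s T2 x - T3 x)"
      by (simp only:)
    then show ?case by (simp add: vec_eq_iff)
  qed
  ultimately show ?thesis by (rule reps_cong)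
qed

text \<open>The germ is a nonzero component of the element that balancedness provides:
  \<open>component_mult_in_balanced\<close> puts it into \<open>J\<close>, and coinduction puts
  \<open>J\<close> into the orbit ideal.\<close>

lemma balanced_orbit_ideal:
  fixes A :: "(complex^'n \<Rightarrow> complex^'n) set set"
  assumes A: "lie_subalg A" and bal: "balanced_in A Der"
  obtains f where "f \<in> orbit_ideal (reps A)" "\<not> (\<forall>\<^sub>F x in nhds 0. f x = 0)"
proof -
  \<comment> \<open>\<open>J\<close> is stable under \<open>A\<close>; a unit in \<open>J\<close> would give \<open>A = Der\<close>.\<close>
  define J where "J = {f. hol f 0 \<and> (\<forall>C. hol_vf C \<longrightarrow> (\<lambda>x. f x *s C x) \<in> reps A)}"
  from bal obtain V where V: "V \<in> reps A" "\<not> (\<forall>\<^sub>F x in nhds 0. V x = 0)"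
    "\<And>W W'. hol_vf W \<Longrightarrow> hol_vf W' \<Longrightarrow> vf_bracket (vf_bracket V W) W' \<in> reps A"
    unfolding balanced_iff[OF A] by blast
  have noideal: "I = {gzero}" if "lie_ideal_in I Der" "I \<subseteq> A" for I
    using bal that unfolding balanced_iff[OF A] by blast
  note hV = reps_hol[OF V(1)]
  have "\<exists>i. \<not> (\<forall>\<^sub>F x in nhds 0. V x $ i = 0)"
  proof (rule ccontr)
    assume "\<not> ?thesis"
    then have "\<forall>\<^sub>F x in nhds 0. \<forall>i. V x $ i = 0"
      by (intro eventually_all_finite) auto
    then show False using V(2) by (simp add: vec_eq_iff)
  qed
  then obtain i where i: "\<not> (\<forall>\<^sub>F x in nhds 0. V x $ i = 0)" ..
  have "(\<lambda>x. V x $ i) \<in> J"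
    unfolding J_def using hV component_mult_in_balanced[OF A hV V(3)] by (simp add: hol_vf_iff)
  moreover have "J \<subseteq> orbit_ideal (reps A)"
  proof (rule orbit_ideal_coinduct)
    fix f assume f: "f \<in> J"
    show hf: "hol f 0" using f by (simp add: J_def)
    show "f 0 = 0"
    proof (rule ccontr)
      assume nz: "f 0 \<noteq> 0"
      have "C \<in> reps A" if C: "hol_vf C" for C :: "complex^'n \<Rightarrow> complex^'n"
      proof -
        have "hol_vf (\<lambda>x. inverse (f x) *s C x)"
          by (intro hol_vf_smult hol_inverse hf nz C)
        then have "(\<lambda>x. f x *s (inverse (f x) *s C x)) \<in> reps A"
          using f unfolding J_def by blast
        moreover have "\<forall>\<^sub>F x in nhds 0. f x *s (inverse (f x) *s C x) = C x"
          using eventually_nonzero[OF hol_cdiff[OF hf] nz] by eventually_elim simp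
        ultimately show ?thesis by (rule reps_cong)
      qed
      then have "Der \<subseteq> A" by (subst reps_mono_iff) (auto simp: reps_Der)
      moreover have "lie_ideal_in (Der :: (complex^'n \<Rightarrow> complex^'n) set set) Der"
        by (simp add: lie_ideal_iff lie_subalg_Der reps_Der hol_vf_bracket)
      ultimately have D: "(Der :: (complex^'n \<Rightarrow> complex^'n) set set) = {gzero}" by (intro noideal)
      \<comment> \<open>Any nonzero constant field contradicts \<open>Der = {gzero}\<close>.\<close>
      define e where "e = (axis undefined 1 :: complex^'n)"
      have "vf_germ (\<lambda>x. e) \<in> Der" by (auto simp: Der_def hol_vf_const)
      then have "vf_germ (\<lambda>x. e) = gzero" by (simp add: D)
      then have "\<forall>\<^sub>F x in nhds (0::complex^'n). e = 0" by (simp add: zero_germ_iff hol_vf_const)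
      then have "e = 0" by (rule eventually_nhds_x_imp_x)
      then show False by (simp add: e_def)
    qed
    fix W assume W: "W \<in> reps A"
    note hW = reps_hol[OF W]
    show "vf_apply W f \<in> J"
      unfolding J_def
    proof (intro CollectI conjI allI impI hol_vf_apply_germ hf hW)
      fix C :: "complex^'n \<Rightarrow> complex^'n" assume C: "hol_vf C"
      \<comment> \<open>\<open>[W, f C] = W(f) C + f [W, C]\<close>, where the left side and the
        last term lie in \<open>A\<close>.\<close>
      have "(\<lambda>x. f x *s C x) \<in> reps A" "(\<lambda>x. f x *s vf_bracket W C x) \<in> reps A"
        using f C hW by (simp_all add: J_def hol_vf_bracket)
      then have "(\<lambda>x. vf_bracket W (\<lambda>x. f x *s C x) x + (-1) *s (f x *s vf_bracket W C x)) \<in> reps A"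
        using lie_add[OF A lie_bracket[OF A W] lie_scale[OF A]] by blast
      moreover have "\<forall>\<^sub>F x in nhds 0. vf_bracket W (\<lambda>x. f x *s C x) x + (-1) *s (f x *s vf_bracket W C x) = vf_apply W f x *s C x"
        using hf hol_vf_vcdiff[OF C] hol_vf_vcdiff[OF hW]
        by eventually_elim (subst vf_bracket_smult_right, simp_all add: vec_eq_iff)
      ultimately show "(\<lambda>x. vf_apply W f x *s C x) \<in> reps A" by (rule reps_cong)
    qed
  qed
  ultimately show ?thesis using that i by blast
qed

text \<open>The inverse function theorem, with \<open>continuous_dd\<close> for the continuity of
  the derivative, gives a real differentiable inverse. Its derivative inverts a complex linear
  bijection and is thus complex linear, so the inverse is holomorphic.\<close>

lemma holomorphic_chart:
  fixes g :: "'n \<Rightarrow> complex^'n \<Rightarrow> complex"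
  assumes hol: "\<And>i. hol (g i) 0" and g0: "\<And>i. g i 0 = 0" and nz: "jac g 0 \<noteq> 0"
  obtains U W \<psi> where "chart U W (\<lambda>x. \<chi> i. g i x) \<psi>"
proof -
  define F where "F = (\<lambda>x. \<chi> i. g i x)"
  have "\<forall>\<^sub>F x in nhds 0. \<forall>i. cdiff (g i) x"
    using hol by (intro eventually_all_finite)
  then obtain S where S: "open S" "0 \<in> S" "\<And>x i. x \<in> S \<Longrightarrow> cdiff (g i) x"
    by (auto simp: eventually_nhds)
  have vF: "vdd F x v = jmat g x *v v" if "x \<in> S" for x v
    using S(3)[OF that] by (simp add: vec_eq_iff vdd_def F_def jmat_def matrix_vector_mult_def dd_expand[of _ x v] mult.commute)
  have dF: "(F has_derivative vdd F x) (at x)" if "x \<in> S" for x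
    using vcdiff_has_derivative[of F x] S(3)[OF that] by (simp add: F_def)
  have bF: "blinfun_apply (Blinfun (vdd F x)) = vdd F x" if "x \<in> S" for x
    using dF[OF that] by (simp add: bounded_linear_Blinfun_apply has_derivative_bounded_linear)
  have cF: "continuous_on S (\<lambda>x. Blinfun (vdd F x))"
  proof (rule continuous_on_blinfun_componentwise)
    fix b :: "complex^'n"
    have "continuous_on S (\<lambda>x. vdd F x b)"
      unfolding vdd_def F_def using S by (intro continuous_on_vec_lambda) (simp add: continuous_dd)
    then show "continuous_on S (\<lambda>x. blinfun_apply (Blinfun (vdd F x)) b)"
      using bF by (simp cong: continuous_on_cong)
  qed
  have "invertible (jmat g 0)" using nz by (simp add: jac_def invertible_det_nz)
  then obtain B where B: "B ** jmat g 0 = mat 1" by (auto simp: invertible_def)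
  have bB: "blinfun_apply (Blinfun ((*v) B)) = (*v) B"
    by (rule bounded_linear_Blinfun_apply) (rule matrix_vector_mul_bounded_linear)
  have inv: "Blinfun ((*v) B) o\<^sub>L Blinfun (vdd F 0) = id_blinfun"
    by (rule blinfun_eqI) (simp add: bB bF S(2) vF matrix_vector_mul_assoc B)
  obtain U' V \<psi> \<psi>' where *: "open U'" "U' \<subseteq> S" "0 \<in> U'" "open V" "F 0 \<in> V" "homeomorphism U' V F \<psi>"
    "\<And>y. y \<in> V \<Longrightarrow> (\<psi> has_derivative (\<psi>' y)) (at y)"
    "\<And>y. y \<in> V \<Longrightarrow> \<psi>' y = Hilbert_Choice.inv (blinfun_apply (Blinfun (vdd F (\<psi> y))))"
    "\<And>y. y \<in> V \<Longrightarrow> bij (blinfun_apply (Blinfun (vdd F (\<psi> y))))"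
    using inverse_function_theorem[of S F "\<lambda>x. Blinfun (vdd F x)" 0 "Blinfun ((*v) B)"] S(1,2) dF bF cF inv
    by (metis (no_types, lifting))
  have hom: "\<And>x. x \<in> U' \<Longrightarrow> F x \<in> V" "\<And>y. y \<in> V \<Longrightarrow> \<psi> y \<in> U'"
    "\<And>x. x \<in> U' \<Longrightarrow> \<psi> (F x) = x" "\<And>y. y \<in> V \<Longrightarrow> F (\<psi> y) = y"
    using *(6) by (auto simp: homeomorphism_def)
  have "chart U' V F \<psi>"
  proof
    show "F 0 = 0" by (simp add: F_def g0 vec_eq_iff)
    show "cdiff (\<lambda>y. F y $ i) x" if "x \<in> U'" for x i
      using that *(2) S(3) by (auto simp: F_def)
    show "cdiff (\<lambda>y. \<psi> y $ i) w" if w: "w \<in> V" for w i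
    proof (rule cdiffI)
      show "((\<lambda>y. \<psi> y $ i) has_derivative (\<lambda>v. \<psi>' w v $ i)) (at w)"
        using bounded_linear.has_derivative[OF bounded_linear_vec_nth *(7)[OF w]] .
      fix c v
      have mem: "\<psi> w \<in> S" using hom(2)[OF w] *(2) by auto
      have bij: "bij (vdd F (\<psi> w))" and p: "\<psi>' w = Hilbert_Choice.inv (vdd F (\<psi> w))"
        using *(8,9)[OF w] bF[OF mem] by simp_all
      have "vdd F (\<psi> w) (c *s \<psi>' w v) = c *s vdd F (\<psi> w) (\<psi>' w v)"
        by (simp add: vF[OF mem] vector_scalar_commute)
      also have "\<dots> = c *s v"
        using bij by (simp add: p bij_is_surj surj_f_inv_f)
      finally have "\<psi>' w (c *s v) = c *s \<psi>' w v"
        using bij by (metis p bij_inv_eq_iff)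
      then show "\<psi>' w (c *s v) $ i = c * \<psi>' w v $ i" by simp
    qed
  qed (use * hom in auto)
  then show ?thesis using that by (simp add: F_def)
qed

text \<open>The set \<open>S\<close> is chosen maximal such that some Jacobian determinant with rows \<open>i \<in> S\<close> taken from \<open>P\<close>
  is not in \<open>P\<close>. A vector field maps such determinants to combinations of them, so if all of
  them vanished at the origin, they would span a stable ideal and hence lie in \<open>P\<close>.\<close>

lemma nondegenerate_system:
  fixes R :: "(complex^'n \<Rightarrow> complex^'n) set"
  assumes R: "\<And>V. V \<in> R \<Longrightarrow> hol_vf V"
  defines "P \<equiv> orbit_ideal R"
  obtains S g where "\<And>i. hol (g i) 0" "\<And>i. g i 0 = 0" "\<And>i. i \<in> S \<Longrightarrow> g i \<in> P" "jac g 0 \<noteq> 0"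
    "\<And>j f. j \<notin> S \<Longrightarrow> f \<in> P \<Longrightarrow> jac (g(j := f)) \<in> P"
proof -
  define adm where "adm = (\<lambda>S g. (\<forall>i::'n. hol (g i) 0) \<and> (\<forall>i\<in>S. g i \<in> P))"
  define Q where "Q = (\<lambda>S. \<exists>g. adm S g \<and> jac g \<notin> P)"
  \<comment> \<open>The coordinate functions have Jacobian determinant 1, and members of
    \<open>P\<close> vanish at 0.\<close>
  have "Q {}"
  proof -
    let ?g = "\<lambda>i x::complex^'n. x $ i"
    have "jmat ?g x = mat 1" for x
      by (simp add: jmat_def mat_def axis_def vec_eq_iff)
    then have "jac ?g 0 \<noteq> 0" by (simp add: jac_def)
    then have "jac ?g \<notin> P" using orbit_idealD(2) unfolding P_def by blast
    then show ?thesis unfolding Q_def adm_def by (intro exI[of _ ?g]) (simp add: hol_intros)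
  qed
  moreover have "\<forall>S. Q S \<longrightarrow> card S < Suc CARD('n)"
    by (simp add: card_mono less_Suc_eq_le)
  ultimately obtain S where S: "Q S" "\<And>S'. Q S' \<Longrightarrow> card S' \<le> card S"
    using ex_has_greatest_nat[of Q "{}" card] by blast
  have "\<exists>g. adm S g \<and> jac g 0 \<noteq> 0"
  proof (rule ccontr)
    assume neg: "\<not> ?thesis"
    define T where "T = {jac g | g. adm S g}"
    have "ospan T \<subseteq> P"
      unfolding P_def
    proof (rule ospan_subset_orbit_ideal)
      show "hol f 0" if "f \<in> T" for f
        using that by (auto simp: T_def adm_def hol_jac)
      show "f 0 = 0" if "f \<in> T" for f
        using that neg by (auto simp: T_def)
      fix f V assume "f \<in> T" and V: "V \<in> R"
      then obtain g where g: "f = jac g" "adm S g" by (auto simp: T_def)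
      have hg: "hol (g i) 0" for i using g(2) by (simp add: adm_def)
      \<comment> \<open>For \<open>i \<in> S\<close> the new entry stays in \<open>P\<close> by
        stability; for other \<open>i\<close> only holomorphy is required.\<close>
      have up: "jac (g(i := vf_apply V (g i))) \<in> T" for i
      proof -
        have "adm S (g(i := vf_apply V (g i)))"
          using g(2) R[OF V] V by (auto simp: adm_def P_def hol_vf_apply_germ orbit_idealD)
        then show ?thesis by (auto simp: T_def)
      qed
      have "(\<lambda>x. (\<Sum>i\<in>UNIV. jac (g(i := vf_apply V (g i))) x) + (- div_vf V x) * f x) \<in> ospan T"
        using R[OF V] up \<open>f \<in> T\<close>
        by (intro ospan_add ospan_sum ospan_mult_base hol_intros hol_div_vf ospan_base) (auto simp: hol_vf_iff)
      moreover have "\<forall>\<^sub>F x in nhds 0. (\<Sum>i\<in>UNIV. jac (g(i := vf_apply V (g i))) x) + (- div_vf V x) * f x = vf_apply V f x"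
      proof -
        have "\<forall>\<^sub>F x in nhds 0. \<forall>i. hol (g i) x"
          using hg by (intro eventually_all_finite) (simp add: eventually_eventually)
        with hol_vf_vcdiff[OF R[OF V]] show ?thesis
          unfolding g(1) by eventually_elim (simp add: vf_apply_jac)
      qed
      ultimately show "vf_apply V f \<in> ospan T" by (rule ospan.cong)
    qed (rule R)
    then have "jac g \<in> P" if "adm S g" for g
      using that ospan_base[of "jac g" T] by (auto simp: T_def)
    then show False using S(1) by (auto simp: Q_def)
  qed
  then obtain g0 where g0: "adm S g0" "jac g0 0 \<noteq> 0" by blast
  \<comment> \<open>Subtracting constants keeps the determinant and does not alter the
    \<open>g0 i\<close> with \<open>i \<in> S\<close>, which are zero at 0 already.\<close>
  define g where "g = (\<lambda>i x. g0 i x - g0 i 0)"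
  have hg0: "hol (g0 i) 0" for i using g0(1) by (simp add: adm_def)
  have hg: "hol (g i) 0" for i unfolding g_def by (intro hol_intros hg0)
  have gP: "g i \<in> P" if "i \<in> S" for i
  proof -
    have "g0 i \<in> P" using g0(1) that by (simp add: adm_def)
    then show ?thesis using orbit_idealD(2)[of "g0 i" R] by (simp add: g_def P_def)
  qed
  have "jmat g 0 = jmat g0 0"
    by (simp add: vec_eq_iff jmat_def g_def dd_diff hol_cdiff[OF hg0])
  then have "jac g 0 \<noteq> 0" using g0(2) by (simp add: jac_def)
  \<comment> \<open>Otherwise \<open>insert j S\<close> would satisfy \<open>Q\<close> and have
    larger cardinality than \<open>S\<close>.\<close>
  moreover have "jac (g(j := f)) \<in> P" if "j \<notin> S" "f \<in> P" for j f
  proof (rule ccontr)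
    assume "jac (g(j := f)) \<notin> P"
    moreover have "adm (insert j S) (g(j := f))"
      using that hg gP orbit_idealD(1)[of f R] by (auto simp: adm_def P_def)
    ultimately have "Q (insert j S)" by (auto simp: Q_def)
    from S(2)[OF this] that(1) show False by simp
  qed
  ultimately show ?thesis
    using that[of g S] hg gP by (simp add: g_def)
qed

text \<open>The \<open>g i\<close> serve as coordinates, and \<open>X\<close> is where those with
  \<open>i \<in> S\<close> vanish. \<open>P\<close> is stable under the coordinate fields along
  \<open>L\<close> and therefore vanishes on \<open>X\<close>. For \<open>V\<close> from
  \<open>A\<close> and \<open>i \<in> S\<close> the germ \<open>V (g i)\<close> is again in
  \<open>P\<close>, hence zero on \<open>X\<close>, and this is tangency of \<open>V\<close>. If
  \<open>L\<close> were the whole space, \<open>f0\<close> would be the zero germ.\<close>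

lemma orbit_tangent:
  fixes A :: "(complex^'n \<Rightarrow> complex^'n) set set"
  assumes A: "A \<subseteq> Der" and f0: "f0 \<in> orbit_ideal (reps A)" "\<not> (\<forall>\<^sub>F x in nhds 0. f0 x = 0)"
  obtains U W \<phi> \<psi> X L where "smooth_chart U W \<phi> \<psi> X L" "L \<noteq> UNIV" "A \<subseteq> tangent_alg X"
proof -
  define P where "P = orbit_ideal (reps A)"
  obtain S g where hg: "\<And>i. hol (g i) 0" and g0: "\<And>i. g i 0 = 0" and gP: "\<And>i. i \<in> S \<Longrightarrow> g i \<in> P"
    and nz: "jac g 0 \<noteq> 0" and gj: "\<And>j f. j \<notin> S \<Longrightarrow> f \<in> P \<Longrightarrow> jac (g(j := f)) \<in> P"
    using nondegenerate_system[of "reps A"] unfolding P_def by (metis reps_hol)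
  obtain U W \<psi> where ch: "chart U W (\<lambda>x. \<chi> i. g i x) \<psi>"
    using holomorphic_chart[OF hg g0 nz] by blast
  define \<phi> where "\<phi> = (\<lambda>x. \<chi> i. g i x)"
  interpret chart U W \<phi> \<psi> using ch by (simp add: \<phi>_def)
  define L where "L = {y::complex^'n. \<forall>i\<in>S. y $ i = 0}"
  define X where "X = {x \<in> U. \<phi> x \<in> L}"
  interpret smooth_chart U W \<phi> \<psi> X L
    by standard (auto simp: L_def X_def subspace_def)
  have Pspan: "s \<in> P" if "s \<in> ospan P" for s
    using ospan_orbit_ideal[of "reps A" s] that by (simp add: P_def reps_hol)
  have U: "\<forall>\<^sub>F x in nhds 0. x \<in> U"
    using open_U zero_U by (rule eventually_nhds_in_open)
  have cg: "cdiff (g i) x" if "x \<in> U" for i x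
    using cdiff_\<phi>[OF that, of i] by (simp add: \<phi>_def)
  \<comment> \<open>By \<open>jac_update\<close> the derivative of \<open>f\<close> along the
    \<open>j\<close>-th coordinate field is \<open>jac (g(j := f)) / jac g\<close>; the numerator is
    in \<open>P\<close> by the choice of \<open>S\<close>, and the denominator is a unit.\<close>
  have axP: "vf_apply (field (axis j 1)) f \<in> P" if j: "j \<notin> S" and f: "f \<in> P" for j f
  proof -
    have hf: "hol f 0" using f by (simp add: P_def orbit_idealD)
    have hj: "hol (jac g) 0" using hg by (rule hol_jac)
    have "(\<lambda>x. inverse (jac g x) * jac (g(j := f)) x) \<in> ospan P"
      by (intro ospan_mult_base gj j f hol_inverse hj nz)
    moreover have "\<forall>\<^sub>F x in nhds 0. inverse (jac g x) * jac (g(j := f)) x = vf_apply (field (axis j 1)) f x"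
      using U hf eventually_nonzero[OF hol_cdiff[OF hj] nz]
    proof eventually_elim
      case (elim x)
      have "vdd \<phi> x (field (axis j 1) x) = axis j 1"
        using vdd_\<phi>_\<psi>[OF \<phi>_W[OF elim(1)]] elim(1) by (simp add: field_def \<psi>_\<phi>)
      then have "dd (g i) x (field (axis j 1) x) = (if i = j then 1 else 0)" for i
        by (simp add: vdd_def \<phi>_def vec_eq_iff axis_def)
      then show ?case
        using jac_update[OF elim(2) cg[OF elim(1)] _ elim(3), of "field (axis j 1) x" j] elim(3)
        by (simp add: vf_apply_def)
    qed
    ultimately have "vf_apply (field (axis j 1)) f \<in> ospan P" by (rule ospan.cong)
    then show ?thesis by (rule Pspan)
  qed
  have LP: "vf_apply (field y) f \<in> P" if y: "y \<in> L" and f: "f \<in> P" for y f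
  proof -
    have hf: "hol f 0" using f by (simp add: P_def orbit_idealD)
    \<comment> \<open>For \<open>y \<in> L\<close> the field is a combination, with constant
      coefficients, of the coordinate fields with index outside \<open>S\<close>.\<close>
    have "(\<lambda>x. \<Sum>j\<in>- S. y $ j * vf_apply (field (axis j 1)) f x) \<in> ospan P"
      by (intro ospan_sum ospan_mult_base axP f hol_intros) simp
    moreover have "\<forall>\<^sub>F x in nhds 0. (\<Sum>j\<in>- S. y $ j * vf_apply (field (axis j 1)) f x) = vf_apply (field y) f x"
      using U hf
    proof eventually_elim
      case (elim x)
      have c: "vcdiff \<psi> (\<phi> x)" "cdiff f (\<psi> (\<phi> x))"
        using elim by (simp_all add: cdiff_\<psi> \<phi>_W \<psi>_\<phi>)
      have e: "vf_apply (field v) f x = dd (\<lambda>w. f (\<psi> w)) (\<phi> x) v" for v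
        using dd_compose[OF c, of v] elim(1) by (simp add: vf_apply_def field_def \<psi>_\<phi>)
      have "vf_apply (field y) f x = (\<Sum>j\<in>UNIV. y $ j * vf_apply (field (axis j 1)) f x)"
        unfolding e by (rule dd_expand) (rule cdiff_compose[OF c])
      also have "\<dots> = (\<Sum>j\<in>- S. y $ j * vf_apply (field (axis j 1)) f x)"
        using y by (intro sum.mono_neutral_right) (auto simp: L_def)
      finally show ?case by simp
    qed
    ultimately have "vf_apply (field y) f \<in> ospan P" by (rule ospan.cong)
    then show ?thesis by (rule Pspan)
  qed
  have van: "\<forall>\<^sub>F x in nhds 0. x \<in> U \<and> (\<phi> x \<in> L \<longrightarrow> f x = 0)" if f: "f \<in> P" for f
  proof -
    have "(vf_apply (field y) ^^ m) f \<in> P" if "y \<in> L" for y m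
      using f LP[OF that] by (induction m) simp_all
    then have it: "(vf_apply (field y) ^^ m) f 0 = 0" if "y \<in> L" for y m
      using that orbit_idealD(2) unfolding P_def by blast
    have "hol f 0" using f by (simp add: P_def orbit_idealD)
    from vanish_near[OF this L(2) it] have "\<forall>\<^sub>F x in nhds 0. \<phi> x \<in> L \<longrightarrow> f x = 0"
      by blast
    with U show ?thesis by eventually_elim simp
  qed
  have "L \<noteq> UNIV"
  proof
    assume "L = UNIV"
    then have "\<forall>\<^sub>F x in nhds 0. f0 x = 0"
      using van[of f0] f0(1) by (auto simp: P_def elim: eventually_mono)
    with f0(2) show False by contradiction
  qed
  moreover have "A \<subseteq> tangent_alg X"
    unfolding reps_mono_iff[OF A]
  proof
    fix V assume V: "V \<in> reps A"
    show "V \<in> reps (tangent_alg X)"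
    proof (rule tangentI[OF reps_hol[OF V]])
      have "\<forall>\<^sub>F x in nhds 0. i \<in> S \<longrightarrow> \<phi> x \<in> L \<longrightarrow> vf_apply V (g i) x = 0" for i
        using van[OF orbit_idealD(3)[OF gP[unfolded P_def] V, folded P_def], of i]
        by (cases "i \<in> S") (auto elim: eventually_mono)
      then have "\<forall>\<^sub>F x in nhds 0. \<forall>i. i \<in> S \<longrightarrow> \<phi> x \<in> L \<longrightarrow> vf_apply V (g i) x = 0"
        by (intro eventually_all_finite)
      then show "\<forall>\<^sub>F x in nhds 0. x \<in> X \<longrightarrow> vdd \<phi> x (V x) \<in> L"
        by eventually_elim (simp add: X_def vdd_def L_def \<phi>_def vf_apply_def)
    qed
  qed
  ultimately show ?thesis using that smooth_chart_axioms by blast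
qed

section \<open>Maximality among balanced subalgebras\<close>

lemma balanced_subset_tangent_alg:
  fixes A :: "(complex^'n \<Rightarrow> complex^'n) set set"
  assumes "balanced_in A Der"
  obtains U W \<phi> \<psi> X L where "smooth_chart U W \<phi> \<psi> X L" "L \<noteq> UNIV" "A \<subseteq> tangent_alg X"
proof -
  have A: "lie_subalg A" "A \<subseteq> Der" using assms by (simp_all add: balanced_in_def)
  obtain f where "f \<in> orbit_ideal (reps A)" "\<not> (\<forall>\<^sub>F x in nhds 0. f x = 0)"
    using balanced_orbit_ideal[OF A(1) assms] .
  from orbit_tangent[OF A(2) this] that show ?thesis by blast
qed

theorem theorem1:
  fixes A :: "(complex^'n \<Rightarrow> complex^'n) set set"
  assumes "lie_subalg A"
  shows "(\<exists>X::(complex^'n) set. smooth_germ X \<and> \<not> empty_germ X \<and> \<not> full_germ X \<and> A = tangent_alg X)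
         \<longleftrightarrow> maximal_visible_in A Der"
proof
  assume "\<exists>X::(complex^'n) set. smooth_germ X \<and> \<not> empty_germ X \<and> \<not> full_germ X \<and> A = tangent_alg X"
  then obtain X :: "(complex^'n) set"
    where X: "smooth_germ X" "\<not> empty_germ X" "\<not> full_germ X" "A = tangent_alg X" by blast
  obtain U W \<phi> \<psi> L where sc: "smooth_chart U W \<phi> \<psi> X L"
    using smooth_germ_chart[OF X(1,2)] .
  have "L \<noteq> UNIV" using smooth_chart.full_germ_if[OF sc] X(3) by blast
  then have "balanced_in A Der" unfolding X(4) by (rule smooth_chart.balanced[OF sc])
  \<comment> \<open>A larger balanced \<open>A'\<close> lies in some \<open>tangent_alg Y\<close>;
    then \<open>tangent_alg X \<subseteq> tangent_alg Y\<close> is an equality, and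
    \<open>A'\<close> is squeezed in between.\<close>
  moreover have "A' = A" if A': "balanced_in A' Der" "A \<subseteq> A'" for A'
  proof -
    obtain U' W' \<phi>' \<psi>' Y M where Y: "smooth_chart U' W' \<phi>' \<psi>' Y M" "M \<noteq> UNIV" "A' \<subseteq> tangent_alg Y"
      using balanced_subset_tangent_alg[OF A'(1)] .
    have "tangent_alg X = tangent_alg Y"
      using tangent_alg_subset_imp_eq[OF sc Y(1,2)] A'(2) Y(3) X(4) by blast
    then show ?thesis using A'(2) Y(3) X(4) by blast
  qed
  ultimately show "maximal_visible_in A Der" by (simp add: maximal_visible_in_def)
next
  assume max: "maximal_visible_in A Der"
  then have "balanced_in A Der" by (simp add: maximal_visible_in_def)
  then obtain U W \<phi> \<psi> X L where X: "smooth_chart U W \<phi> \<psi> X L" "L \<noteq> UNIV" "A \<subseteq> tangent_alg X"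
    using balanced_subset_tangent_alg by blast
  \<comment> \<open>\<open>tangent_alg X\<close> is itself balanced, so the maximality of
    \<open>A\<close> turns the inclusion into an equality.\<close>
  have "A = tangent_alg X"
    using max X(3) smooth_chart.balanced[OF X(1,2)] by (auto simp: maximal_visible_in_def)
  moreover have "\<not> full_germ X"
    using smooth_chart.not_full[OF X(1,2)] .
  ultimately show "\<exists>X::(complex^'n) set. smooth_germ X \<and> \<not> empty_germ X \<and> \<not> full_germ X \<and> A = tangent_alg X"
    using smooth_chart.smooth[OF X(1)] smooth_chart.not_empty[OF X(1)] by blast
qed

end
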